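(* Let $n\ge 4$ be an integer. If the algorithm $\mathrm{Generate}(n)$ (described in the context) terminates, then the list $\mathcal H$ it outputs is the list of all hypohamiltonian graphs with $n$ vertices, up to isomorphism: every graph in $\mathcal H$ is a hypohamiltonian graph with $n$ vertices, and every hypohamiltonian graph with $n$ vertices is isomorphic to exactly one graph in $\mathcal H$.
   Context: Input and intermediate graphs are finite, undirected, without loops or multiple edges. A graph is hamiltonian if it contains a cycle visiting every vertex. A graph $G$ is hypohamiltonian if it is non-hamiltonian and $G-v$ is hamiltonian for every $v\in V(G)$. $\Delta(G)$ is the maximum degree, $G[S]$ is the subgraph induced by $S$, and $G+e$ is $G$ with the edge $e$ (joining two existing non-adjacent vertices) added. Parameters. For a possibly disconnected graph $G$, let $p(G)$ be the minimum number of disjoint paths needed to cover all vertices of $G$, let $V_1=V_1(G)$ be the set of vertices of degree $1$ in $G$, and let $I(G)$ be the set of all isolated vertices and all isolated $K_2$'s (components that are a single edge with its endpoints) of $G$. Define $k(G)=0$ if $G$ is empty (has no vertices); $k(G)=\max\{1,\lceil |V_1|/2\rceil\}$ if $I(G)=\emptyset$ but $G$ is not empty; and $k(G)=|I(G)|+k(G-I(G))$ otherwise. Obstructions. Let $(W,X)$ be a partition of $V(G)$ with $|W|>1$ and $|X|>1$. Type A obstruction: $(W,X)$ such that $G[W]$ is a union of disjoint paths and $p(G[W])\ge |X|$. A good $A$-edge for it is a non-edge of $G$ whose endpoints lie in different components of $G[W]$. Type B obstruction: $(W,X)$ such that $k(G[W])\ge |X|$. A good $B$-edge for it is a non-edge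 of $G$ joining two vertices of $W$, at least one of which has degree at most one in $G[W]$. Type C obstruction: $(W,X,v)$ such that $W$ is an independent set, $v\in X$, and $2n_2+n_1<2|W|$, where $n_1$ and $n_2$ are the numbers of vertices of $X-v$ joined to exactly one, respectively more than one, vertex of $W$. A good $C$-edge for it is a non-edge $e$ of $G$ such that either both endpoints of $e$ are in $W$, or one endpoint of $e$ is in $W$ and the other endpoint is in $X-v$ and has at most one neighbour in $W$. Algorithm $\mathrm{Generate}(n)$. Let $\mathcal H$ be an empty list, and let $G$ be the disjoint union of a cycle $C_{n-1}$ on $n-1$ vertices and an isolated vertex $h$. For every $D$ with $3\le D\le n-1$, and for every way of connecting $h$ with $D$ vertices of $C_{n-1}$, call the resulting graph $G'$ and perform $\mathrm{Construct}(G',D)$. Finally output $\mathcal H$. Procedure $\mathrm{Construct}(G,D)$. If $G$ is hamiltonian, or a graph isomorphic to $G$ has been generated before, do nothing. Otherwise execute the first applicable case of the following: (1) If $G$ contains a type A obstruction $(W,X)$: for every good $A$-edge $e\notin E(G)$ for $(W,X)$ with $\Delta(G+e)=D$, call $\mathrm{Construct}(G+e,D)$. (2) Else, if $G$ contains a vertex $v$ of degree $2$: for every $e\notin E(G)$ which contains $v$ as an endpoint and for which $\Delta(G+e)=D$, call $\mathrm{Construct}(G+e,D)$. (3) Else, if $G$ contains a type C obstruction $(W,X,v)$: for every good $C$-edge $e\notin E(G)$ for $(W,X,v)$ with $\Delta(G+e)=D$, call $\mathrm{Construct}(G+e,D)$. (4) Else, if $G$ contains a vertex $v$ of degree $3$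 which is part of a triangle: for every $e\notin E(G)$ which contains $v$ as an endpoint and for which $\Delta(G+e)=D$, call $\mathrm{Construct}(G+e,D)$. (5) Else, if $G$ contains a type B obstruction $(W,X)$: for every good $B$-edge $e\notin E(G)$ for $(W,X)$ with $\Delta(G+e)=D$, call $\mathrm{Construct}(G+e,D)$. (6) Else: if $G$ is hypohamiltonian, add $G$ to $\mathcal H$; then (in either case) for every $e\notin E(G)$ with $\Delta(G+e)=D$, call $\mathrm{Construct}(G+e,D)$. In cases (1)-(5), one obstruction (or vertex) of the indicated kind is chosen and used. *)

theory Defs
  imports Complex_Main
begin

section \<open>Finite simple graphs\<close>

record 'a ugraph =
  verts :: "'a set"
  edges :: "'a set set"

definition simple_graph :: "'a ugraph \<Rightarrow> bool" where
  "simple_graph G \<longleftrightarrow> finite (verts G) \<and> (\<forall>e\<in>edges G. e \<subseteq> verts G \<and> card e = 2)"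

definition nonedges :: "'a ugraph \<Rightarrow> 'a set set" where
  "nonedges G = {e. e \<subseteq> verts G \<and> card e = 2 \<and> e \<notin> edges G}"

definition add_edge :: "'a ugraph \<Rightarrow> 'a set \<Rightarrow> 'a ugraph" where
  "add_edge G e = \<lparr>verts = verts G, edges = insert e (edges G)\<rparr>"

definition induced :: "'a ugraph \<Rightarrow> 'a set \<Rightarrow> 'a ugraph" where
  "induced G S = \<lparr>verts = verts G \<inter> S, edges = {e \<in> edges G. e \<subseteq> S}\<rparr>"

definition remove_verts :: "'a ugraph \<Rightarrow> 'a set \<Rightarrow> 'a ugraph" where
  "remove_verts G S = induced G (verts G - S)"

definition degree :: "'a ugraph \<Rightarrow> 'a \<Rightarrow> nat" where
  "degree G v = card {e \<in> edges G. v \<in> e}"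

definition max_degree :: "'a ugraph \<Rightarrow> nat" where
  "max_degree G = Max (degree G ` verts G)"

definition graph_iso :: "'a ugraph \<Rightarrow> 'b ugraph \<Rightarrow> bool" where
  "graph_iso G H \<longleftrightarrow> (\<exists>f. bij_betw f (verts G) (verts H) \<and>
     (\<forall>u\<in>verts G. \<forall>v\<in>verts G. {u, v} \<in> edges G \<longleftrightarrow> {f u, f v} \<in> edges H))"

definition is_path :: "'a ugraph \<Rightarrow> 'a list \<Rightarrow> bool" where
  "is_path G vs \<longleftrightarrow> vs \<noteq> [] \<and> distinct vs \<and> set vs \<subseteq> verts G \<and>
     successively (\<lambda>u v. {u, v} \<in> edges G) vs"

definition is_cycle :: "'a ugraph \<Rightarrow> 'a list \<Rightarrow> bool" where
  "is_cycle G vs \<longleftrightarrow> is_path G vs \<and> length vs \<ge> 3 \<and> {last vs, hd vs} \<in> edges G"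

definition hamiltonian :: "'a ugraph \<Rightarrow> bool" where
  "hamiltonian G \<longleftrightarrow> (\<exists>vs. is_cycle G vs \<and> set vs = verts G)"

definition hypohamiltonian :: "'a ugraph \<Rightarrow> bool" where
  "hypohamiltonian G \<longleftrightarrow>
     \<not> hamiltonian G \<and> (\<forall>v\<in>verts G. hamiltonian (remove_verts G {v}))"

definition component :: "'a ugraph \<Rightarrow> 'a \<Rightarrow> 'a set" where
  "component G u = {v \<in> verts G. (\<lambda>x y. {x, y} \<in> edges G)\<^sup>*\<^sup>* u v}"

definition components :: "'a ugraph \<Rightarrow> 'a set set" where
  "components G = component G ` verts G"


section \<open>The parameters p and k\<close>

definition path_graph :: "'a ugraph \<Rightarrow> bool" where
  "path_graph G \<longleftrightarrow> (\<exists>vs. vs \<noteq> [] \<and> distinct vs \<and> verts G = set vs \<and>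
     edges G = {{vs ! i, vs ! Suc i} | i. Suc i < length vs})"

definition union_of_disjoint_paths :: "'a ugraph \<Rightarrow> bool" where
  "union_of_disjoint_paths G \<longleftrightarrow> (\<forall>C\<in>components G. path_graph (induced G C))"

definition path_cover :: "'a ugraph \<Rightarrow> 'a list set \<Rightarrow> bool" where
  "path_cover G P \<longleftrightarrow> finite P \<and> (\<forall>vs\<in>P. is_path G vs) \<and>
     (\<forall>vs\<in>P. \<forall>ws\<in>P. vs \<noteq> ws \<longrightarrow> set vs \<inter> set ws = {}) \<and> (\<Union>vs\<in>P. set vs) = verts G"

definition p_num :: "'a ugraph \<Rightarrow> nat" where
  "p_num G = (LEAST m. \<exists>P. path_cover G P \<and> card P = m)"

definition V1 :: "'a ugraph \<Rightarrow> 'a set" where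
  "V1 G = {v \<in> verts G. degree G v = 1}"

text \<open>The isolated vertices and isolated \<open>K\<^sub>2\<close>'s are represented by their vertex sets, so
  an isolated \<open>K\<^sub>2\<close> counts once in the cardinality. A component equal to an edge \<open>{u, v}\<close>
  is an isolated \<open>K\<^sub>2\<close>, the graph being simple.\<close>

definition I_comps :: "'a ugraph \<Rightarrow> 'a set set" where
  "I_comps G = {C \<in> components G. (\<exists>v. C = {v}) \<or> C \<in> edges G}"

lemma card_remove_I_comps:
  assumes "finite (verts G)" "I_comps G \<noteq> {}"
  shows "card (verts (remove_verts G (\<Union>(I_comps G)))) < card (verts G)"
proof -
  obtain C where "C \<in> I_comps G" using assms(2) by blast
  moreover from this obtain u where "u \<in> verts G" "u \<in> C"
    unfolding I_comps_def components_def component_def by auto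
  ultimately have "verts (remove_verts G (\<Union>(I_comps G))) \<subset> verts G"
    unfolding remove_verts_def induced_def by auto
  then show ?thesis using assms(1) by (simp add: psubset_card_mono)
qed

text \<open>Infinite vertex sets, which are irrelevant, get the value 0 so that the recursion
  terminates.\<close>

function k_num :: "'a ugraph \<Rightarrow> nat" where
  "k_num G =
    (if infinite (verts G) \<or> verts G = {} then 0
     else if I_comps G = {} then max 1 (nat \<lceil>real (card (V1 G)) / 2\<rceil>)
     else card (I_comps G) + k_num (remove_verts G (\<Union>(I_comps G))))"
  by auto
termination
  by (relation "measure (\<lambda>G. card (verts G))") (auto simp: card_remove_I_comps)

declare k_num.simps [simp del]


section \<open>Obstructions and good edges\<close>

definition two_partition :: "'a ugraph \<Rightarrow> 'a set \<Rightarrow> 'a set \<Rightarrow> bool" where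
  "two_partition G W X \<longleftrightarrow>
     W \<union> X = verts G \<and> W \<inter> X = {} \<and> card W > 1 \<and> card X > 1"

definition type_A :: "'a ugraph \<Rightarrow> 'a set \<Rightarrow> 'a set \<Rightarrow> bool" where
  "type_A G W X \<longleftrightarrow> two_partition G W X \<and>
     union_of_disjoint_paths (induced G W) \<and> p_num (induced G W) \<ge> card X"

definition good_A :: "'a ugraph \<Rightarrow> 'a set \<Rightarrow> 'a set set" where
  "good_A G W = {e \<in> nonedges G. \<exists>C\<in>components (induced G W). \<exists>C'\<in>components (induced G W).
     C \<noteq> C' \<and> (\<exists>u\<in>C. \<exists>v\<in>C'. e = {u, v})}"

definition type_B :: "'a ugraph \<Rightarrow> 'a set \<Rightarrow> 'a set \<Rightarrow> bool" where
  "type_B G W X \<longleftrightarrow> two_partition G W X \<and> k_num (induced G W) \<ge> card X"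

definition good_B :: "'a ugraph \<Rightarrow> 'a set \<Rightarrow> 'a set set" where
  "good_B G W = {e \<in> nonedges G. e \<subseteq> W \<and> (\<exists>u\<in>e. degree (induced G W) u \<le> 1)}"

definition nbrs_in :: "'a ugraph \<Rightarrow> 'a set \<Rightarrow> 'a \<Rightarrow> 'a set" where
  "nbrs_in G W x = {w \<in> W. {x, w} \<in> edges G}"

definition type_C :: "'a ugraph \<Rightarrow> 'a set \<Rightarrow> 'a set \<Rightarrow> 'a \<Rightarrow> bool" where
  "type_C G W X v \<longleftrightarrow> two_partition G W X \<and>
     (\<forall>u\<in>W. \<forall>w\<in>W. {u, w} \<notin> edges G) \<and> v \<in> X \<and>
     2 * card {x \<in> X - {v}. card (nbrs_in G W x) > 1}
       + card {x \<in> X - {v}. card (nbrs_in G W x) = 1} < 2 * card W"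

definition good_C :: "'a ugraph \<Rightarrow> 'a set \<Rightarrow> 'a set \<Rightarrow> 'a \<Rightarrow> 'a set set" where
  "good_C G W X v = {e \<in> nonedges G. e \<subseteq> W \<or>
     (\<exists>w\<in>W. \<exists>x\<in>X - {v}. e = {w, x} \<and> card (nbrs_in G W x) \<le> 1)}"


section \<open>The algorithm\<close>

definition deg2_vertex :: "'a ugraph \<Rightarrow> 'a \<Rightarrow> bool" where
  "deg2_vertex G v \<longleftrightarrow> v \<in> verts G \<and> degree G v = 2"

definition deg3_triangle_vertex :: "'a ugraph \<Rightarrow> 'a \<Rightarrow> bool" where
  "deg3_triangle_vertex G v \<longleftrightarrow> v \<in> verts G \<and> degree G v = 3 \<and>
     (\<exists>u w. {u, v} \<in> edges G \<and> {v, w} \<in> edges G \<and> {u, w} \<in> edges G)"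

definition has_A :: "'a ugraph \<Rightarrow> bool" where
  "has_A G \<longleftrightarrow> (\<exists>W X. type_A G W X)"

definition has_deg2 :: "'a ugraph \<Rightarrow> bool" where
  "has_deg2 G \<longleftrightarrow> (\<exists>v. deg2_vertex G v)"

definition has_C :: "'a ugraph \<Rightarrow> bool" where
  "has_C G \<longleftrightarrow> (\<exists>W X v. type_C G W X v)"

definition has_deg3_triangle :: "'a ugraph \<Rightarrow> bool" where
  "has_deg3_triangle G \<longleftrightarrow> (\<exists>v. deg3_triangle_vertex G v)"

definition has_B :: "'a ugraph \<Rightarrow> bool" where
  "has_B G \<longleftrightarrow> (\<exists>W X. type_B G W X)"

definition last_case :: "'a ugraph \<Rightarrow> bool" where
  "last_case G \<longleftrightarrow> \<not> has_A G \<and> \<not> has_deg2 G \<and> \<not> has_C G \<and> \<not> has_deg3_triangle G \<and> \<not> has_B G"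

text \<open>\<open>candidates G E\<close>: the first applicable case, with some choice of the obstruction or
  vertex, considers the non-edges in \<open>E\<close> (before the test on the maximum degree).\<close>

inductive candidates :: "'a ugraph \<Rightarrow> 'a set set \<Rightarrow> bool" for G where
  case_A: "type_A G W X \<Longrightarrow> candidates G (good_A G W)"
| case_deg2: "\<lbrakk>\<not> has_A G; deg2_vertex G v\<rbrakk>
    \<Longrightarrow> candidates G {e \<in> nonedges G. v \<in> e}"
| case_C: "\<lbrakk>\<not> has_A G; \<not> has_deg2 G; type_C G W X v\<rbrakk>
    \<Longrightarrow> candidates G (good_C G W X v)"
| case_deg3_triangle:
    "\<lbrakk>\<not> has_A G; \<not> has_deg2 G; \<not> has_C G; deg3_triangle_vertex G v\<rbrakk>
    \<Longrightarrow> candidates G {e \<in> nonedges G. v \<in> e}"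
| case_B: "\<lbrakk>\<not> has_A G; \<not> has_deg2 G; \<not> has_C G; \<not> has_deg3_triangle G; type_B G W X\<rbrakk>
    \<Longrightarrow> candidates G (good_B G W)"
| case_last: "last_case G \<Longrightarrow> candidates G (nonedges G)"

text \<open>The state consists of the set of all graphs on which \<open>Construct\<close> has been called so far
  and of the output list. \<open>construct G D s s'\<close> means that some execution of
  \<open>Construct(G, D)\<close> started in state \<open>s\<close> terminates in state \<open>s'\<close>; \<open>construct_all\<close> performs
  a list of calls one after another. The choice of the obstruction or vertex and the order of
  the loops are left open, so these relations comprise all executions.\<close>

type_synonym 'a state = "'a ugraph set \<times> 'a ugraph list"

inductive construct :: "'a ugraph \<Rightarrow> nat \<Rightarrow> 'a state \<Rightarrow> 'a state \<Rightarrow> bool"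
  and construct_all :: "('a ugraph \<times> nat) list \<Rightarrow> 'a state \<Rightarrow> 'a state \<Rightarrow> bool"
where
  construct_skip:
    "hamiltonian G \<or> (\<exists>G'\<in>gen. graph_iso G G')
     \<Longrightarrow> construct G D (gen, Hs) (insert G gen, Hs)"
| construct_branch:
    "\<lbrakk>\<not> hamiltonian G; \<not> (\<exists>G'\<in>gen. graph_iso G G');
      candidates G E;
      distinct es; set es = {e \<in> E. max_degree (add_edge G e) = D};
      Hs' = (if last_case G \<and> hypohamiltonian G then Hs @ [G] else Hs);
      construct_all (map (\<lambda>e. (add_edge G e, D)) es) (insert G gen, Hs') s'\<rbrakk>
     \<Longrightarrow> construct G D (gen, Hs) s'"
| construct_all_Nil: "construct_all [] s s"
| construct_all_Cons:
    "\<lbrakk>construct G D s s'; construct_all cs s' s''\<rbrakk>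
     \<Longrightarrow> construct_all ((G, D) # cs) s s''"

text \<open>The cycle has the vertices \<open>0, \<dots>, n - 2\<close>, and \<open>h\<close> is the vertex \<open>n - 1\<close>.\<close>

definition cycle_and_isolated :: "nat \<Rightarrow> nat ugraph" where
  "cycle_and_isolated n =
     \<lparr>verts = {..<n}, edges = {{i, (i + 1) mod (n - 1)} | i. i < n - 1}\<rparr>"

definition connect_h :: "nat \<Rightarrow> nat set \<Rightarrow> nat ugraph" where
  "connect_h n S =
     \<lparr>verts = verts (cycle_and_isolated n),
      edges = edges (cycle_and_isolated n) \<union> {{n - 1, v} | v. v \<in> S}\<rparr>"

text \<open>\<open>generate n Hs\<close>: some execution of \<open>Generate(n)\<close> terminates with output \<open>Hs\<close>.\<close>

definition generate :: "nat \<Rightarrow> nat ugraph list \<Rightarrow> bool" where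
  "generate n Hs \<longleftrightarrow> (\<exists>starts gen.
     distinct starts \<and>
     set starts = {(D, S). 3 \<le> D \<and> D \<le> n - 1 \<and> S \<subseteq> {..<n - 1} \<and> card S = D} \<and>
     construct_all (map (\<lambda>(D, S). (connect_h n S, D)) starts) ({}, []) (gen, Hs))"


section \<open>Executions exist\<close>

text \<open>So the hypothesis \<open>generate n Hs\<close> is never vacuous.\<close>

lemma candidates_exist: "\<exists>E. candidates G E"
proof (cases "last_case G")
  case True then show ?thesis by (blast intro: case_last)
next
  case False
  consider "has_A G" | "\<not> has_A G" "has_deg2 G" | "\<not> has_A G" "\<not> has_deg2 G" "has_C G"
    | "\<not> has_A G" "\<not> has_deg2 G" "\<not> has_C G" "has_deg3_triangle G"
    | "\<not> has_A G" "\<not> has_deg2 G" "\<not> has_C G" "\<not> has_deg3_triangle G" "has_B G"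
    using False unfolding last_case_def by blast
  then show ?thesis
  proof cases
    case 1 then obtain W X where "type_A G W X" unfolding has_A_def by blast
    then show ?thesis by (intro exI, rule case_A)
  next
    case 2 then obtain v where v: "deg2_vertex G v" unfolding has_deg2_def by blast
    show ?thesis by (rule exI, rule case_deg2[OF 2(1) v])
  next
    case 3 then obtain W X v where v: "type_C G W X v" unfolding has_C_def by blast
    show ?thesis by (rule exI, rule case_C[OF 3(1,2) v])
  next
    case 4 then obtain v where v: "deg3_triangle_vertex G v" unfolding has_deg3_triangle_def by blast
    show ?thesis by (rule exI, rule case_deg3_triangle[OF 4(1-3) v])
  next
    case 5 then obtain W X where v: "type_B G W X" unfolding has_B_def by blast
    show ?thesis by (rule exI, rule case_B[OF 5(1-4) v])
  qed
qed

lemma candidates_nonedges: "candidates G E \<Longrightarrow> E \<subseteq> nonedges G"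
  by (induction rule: candidates.induct) (auto simp: good_A_def good_B_def good_C_def)

lemma construct_all_total:
  assumes "\<And>G D s. (G, D) \<in> set cs \<Longrightarrow> \<exists>s'. construct G D s s'"
  shows "\<exists>s'. construct_all cs s s'"
  using assms
proof (induction cs arbitrary: s)
  case Nil then show ?case by (blast intro: construct_all_Nil)
next
  case (Cons c cs)
  obtain G D where c: "c = (G, D)" by fastforce
  obtain s1 where "construct G D s s1" using Cons.prems[of G D s] c by auto
  moreover obtain s2 where "construct_all cs s1 s2" using Cons.IH[of s1] Cons.prems by (metis list.set_intros(2))
  ultimately have "construct_all (c # cs) s s2" unfolding c by (rule construct_all_Cons)
  then show ?case ..
qed

lemma construct_total: "finite (verts G) \<Longrightarrow> \<exists>s'. construct G D s s'"
proof (induction "card (nonedges G)" arbitrary: G s rule: less_induct)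
  case less
  obtain gen Hs where s: "s = (gen, Hs)" by fastforce
  show ?case
  proof (cases "hamiltonian G \<or> (\<exists>G'\<in>gen. graph_iso G G')")
    case True then show ?thesis unfolding s by (blast intro: construct_skip)
  next
    case False
    obtain E where E: "candidates G E" using candidates_exist by blast
    have fin: "finite (nonedges G)" unfolding nonedges_def
      by (rule finite_subset[of _ "Pow (verts G)"]) (use less.prems in auto)
    have sub: "E \<subseteq> nonedges G" using candidates_nonedges[OF E] .
    have fe: "finite {e \<in> E. max_degree (add_edge G e) = D}" using fin sub finite_subset by fastforce
    then obtain es where es: "set es = {e \<in> E. max_degree (add_edge G e) = D}" "distinct es"
      using finite_distinct_list[OF fe] by (elim exE conjE)
    have IH: "\<exists>s'. construct (add_edge G e) D t s'" if e: "e \<in> E" for e t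
    proof (rule less.hyps)
      have "nonedges (add_edge G e) = nonedges G - {e}"
        unfolding nonedges_def add_edge_def by auto
      then show "card (nonedges (add_edge G e)) < card (nonedges G)"
        using fin e sub by (metis card_Diff1_less subsetD)
      show "finite (verts (add_edge G e))" using less.prems by (simp add: add_edge_def)
    qed
    define Hs' where "Hs' = (if last_case G \<and> hypohamiltonian G then Hs @ [G] else Hs)"
    have "\<exists>s'. construct_all (map (\<lambda>e. (add_edge G e, D)) es) (insert G gen, Hs') s'"
    proof (rule construct_all_total)
      fix K D' t assume "(K, D') \<in> set (map (\<lambda>e. (add_edge G e, D)) es)"
      then obtain e where "e \<in> E" "K = add_edge G e" "D' = D" using es(1) by auto
      then show "\<exists>s'. construct K D' t s'" using IH[of e t] by simp
    qed
    then obtain s' where s': "construct_all (map (\<lambda>e. (add_edge G e, D)) es) (insert G gen, Hs') s'" ..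
    have "construct G D (gen, Hs) s'"
      by (rule construct_branch[OF _ _ E es(2,1) Hs'_def s']) (use False in blast)+
    then show ?thesis unfolding s ..
  qed
qed

lemma generate_total: "\<exists>Hs. generate n Hs"
proof -
  let ?S = "{(D, S). 3 \<le> D \<and> D \<le> n - 1 \<and> S \<subseteq> {..<n - 1} \<and> card S = D}"
  have fS: "finite ?S" by (rule finite_subset[of _ "{..n - 1} \<times> Pow {..<n - 1}"]) auto
  then obtain st where st: "set st = ?S" "distinct st" using finite_distinct_list[OF fS] by (elim exE conjE)
  have "\<exists>s'. construct_all (map (\<lambda>(D, S). (connect_h n S, D)) st) ({}, []) s'"
    by (rule construct_all_total, rule construct_total)
       (auto simp: connect_h_def cycle_and_isolated_def)
  then obtain gen Hs where "construct_all (map (\<lambda>(D, S). (connect_h n S, D)) st) ({}, []) (gen, Hs)"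
    by (metis surj_pair)
  with st have "generate n Hs" unfolding generate_def by (intro exI[of _ st] exI[of _ gen] conjI)
  then show ?thesis ..
qed

end

theory Submission
  imports Defs
begin

text \<open>Let \<open>K\<close> be a spanning subgraph of a hypohamiltonian graph \<open>G\<close>. A hamiltonian cycle of \<open>G - x\<close>
  with \<open>x \<in> X\<close> enters \<open>W\<close> at most \<open>|X| - 1\<close> times, so an obstruction of \<open>K\<close> cannot persist in \<open>G\<close>:
  some good edge of \<open>K\<close> belongs to \<open>G\<close>. Likewise \<open>G\<close> has neither a vertex of degree two nor a
  vertex of degree three in a triangle. Hence the search, started from a hamiltonian cycle of
  \<open>G - h\<close> together with all edges at a vertex \<open>h\<close> of maximum degree, can always be continued
  towards \<open>G\<close> up to isomorphism. Skipping a graph that has occurred before does no harm, as the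
  earlier call is completely processed by the time the whole search has ended.\<close>

section \<open>Hamiltonian cycles as cyclic permutations\<close>

text \<open>An actual run need not contain a chain of calls from a start graph to \<open>G\<close>:
  a call on the way may be skipped in favour of an isomorphic graph with other labels, possibly one
  whose own calls are still in progress. So no path is followed during the run. An invariant records
  what the final state guarantees for every graph on which \<open>construct\<close> was called, and
  the path towards \<open>G\<close> is replaced by an extremal choice made in that state, where
  \<open>G\<close> may vary over its relabelled copies. The degree test never blocks an edge of
  \<open>G\<close>: with all edges at \<open>h\<close> present, every graph between the start graph
  and \<open>G\<close> has the maximum degree of \<open>G\<close>. For the same reason
  \<open>D\<close> can be read off from a generated graph. Uniqueness comes from the isomorphism
  test alone, which sees all earlier outputs.\<close>

lemma is_cycle_rotate1:
  assumes "is_cycle G vs"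
  shows "is_cycle G (rotate1 vs)"
proof -
  obtain x y ys where vs: "vs = x # y # ys"
    using assms unfolding is_cycle_def by (cases vs; cases "tl vs") auto
  show ?thesis using assms successively_append_iff[of _ "y # ys" "[x]"]
    unfolding vs is_cycle_def is_path_def by (auto simp: insert_commute split: if_splits)
qed

lemma is_cycle_rotate: "is_cycle G vs \<Longrightarrow> is_cycle G (rotate k vs)"
  by (induction k) (auto simp: is_cycle_rotate1)

text \<open>The cycle as a permutation, so that its passages between two sets can be counted by
  injectivity. The last clause forces a single orbit; \<open>s (s u) \<noteq> u\<close> excludes an
  edge run back and forth.\<close>

definition cyclic_succ :: "'a ugraph \<Rightarrow> ('a \<Rightarrow> 'a) \<Rightarrow> bool" where
  "cyclic_succ G s \<longleftrightarrow> bij_betw s (verts G) (verts G) \<and>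
     (\<forall>u\<in>verts G. {u, s u} \<in> edges G \<and> s (s u) \<noteq> u) \<and>
     (\<forall>A\<subseteq>verts G. A \<noteq> {} \<longrightarrow> s ` A \<subseteq> A \<longrightarrow> A = verts G)"

text \<open>The list form is kept too, rotated so that any chosen edge \<open>{u, s u}\<close>
  closes the cycle; a further vertex can then be inserted into that edge by prepending it.\<close>

lemma hamiltonian_cyclic_succ:
  assumes "hamiltonian G"
  obtains s where "cyclic_succ G s"
    "\<And>u. u \<in> verts G \<Longrightarrow> \<exists>vs. is_cycle G vs \<and> set vs = verts G \<and> last vs = u \<and> hd vs = s u"
proof -
  obtain vs where cyc: "is_cycle G vs" and vs: "set vs = verts G"
    using assms unfolding hamiltonian_def by blast
  define m where "m = length vs"
  have m: "m \<ge> 3" and d: "distinct vs"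
    using cyc unfolding is_cycle_def is_path_def m_def by auto
  have bij: "bij_betw ((!) vs) {..<m} (verts G)"
    using bij_betw_nth[OF d refl refl] vs m_def by (simp add: lessThan_def)
  define s where "s u = vs ! (Suc (the_inv_into {..<m} ((!) vs) u) mod m)" for u
  have s: "s (vs ! i) = vs ! (Suc i mod m)" if "i < m" for i
    unfolding s_def using the_inv_into_f_f[OF bij_betw_imp_inj_on[OF bij]] that by simp
  have ex: "\<exists>i<m. u = vs ! i" if "u \<in> verts G" for u
    using that vs m_def by (metis in_set_conv_nth)
  have rot: "is_cycle G (rotate (Suc i) vs) \<and> set (rotate (Suc i) vs) = verts G \<and>
      last (rotate (Suc i) vs) = vs ! i \<and> hd (rotate (Suc i) vs) = s (vs ! i)" if i: "i < m" for i
  proof -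
    have ne: "vs \<noteq> []" using m m_def by auto
    have "last (rotate (Suc i) vs) = vs ! ((Suc i + (m - 1)) mod m)"
      using ne m m_def
      by (subst last_conv_nth) (simp_all add: nth_rotate del: rotate_Suc)
    also have "(Suc i + (m - 1)) mod m = i" using i m by simp
    finally have "last (rotate (Suc i) vs) = vs ! i" .
    moreover have "hd (rotate (Suc i) vs) = s (vs ! i)"
      using s[OF i] hd_rotate_conv_nth[OF ne, of "Suc i"] m_def by simp
    ultimately show ?thesis using is_cycle_rotate[OF cyc, of "Suc i"] vs by simp
  qed
  have step: "{u, s u} \<in> edges G" if "u \<in> verts G" for u
    using ex[OF that] rot unfolding is_cycle_def by metis
  have inj: "vs ! i = vs ! j \<longleftrightarrow> i = j" if "i < m" "j < m" for i j
    using d that m_def nth_eq_iff_index_eq by blast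
  have ss: "s (s u) \<noteq> u" if u: "u \<in> verts G" for u
  proof -
    obtain i where i: "i < m" "u = vs ! i" using ex[OF u] by blast
    have "Suc (Suc i mod m) mod m \<noteq> i"
      using i(1) m by (cases "Suc i = m"; cases "Suc (Suc i) = m") auto
    then show ?thesis using i s m inj by simp
  qed
  have sV: "s u \<in> verts G" if u: "u \<in> verts G" for u
  proof -
    obtain i where i: "i < m" "u = vs ! i" using ex[OF u] by blast
    have "Suc i mod m < length vs" unfolding m_def[symmetric] using m by (intro mod_less_divisor) simp
    then show ?thesis using s[OF i(1)] i(2) vs nth_mem by metis
  qed
  have injs: "inj_on s (verts G)"
  proof (rule inj_onI)
    fix u w assume "u \<in> verts G" "w \<in> verts G" and eq: "s u = s w"
    then obtain i j where ij: "i < m" "u = vs ! i" "j < m" "w = vs ! j" using ex by metis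
    have "Suc i mod m = Suc j mod m" using eq ij s inj m by simp
    then have "i = j" using ij(1,3) by (auto simp: mod_Suc split: if_splits)
    then show "u = w" using ij by simp
  qed
  have fin: "finite (verts G)" using vs by (metis List.finite_set)
  have "s ` verts G = verts G"
    by (rule endo_inj_surj[OF fin _ injs]) (use sV in auto)
  then have bs: "bij_betw s (verts G) (verts G)" using injs by (simp add: bij_betw_def)
  have cl: "A = verts G" if A: "A \<subseteq> verts G" "A \<noteq> {}" "s ` A \<subseteq> A" for A
  proof -
    obtain i where i: "i < m" "vs ! i \<in> A" using A ex by blast
    have iter: "vs ! ((i + k) mod m) \<in> A" for k
    proof (induction k)
      case 0 then show ?case using i by simp
    next
      case (Suc k)
      have "s (vs ! ((i + k) mod m)) = vs ! ((i + Suc k) mod m)"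
        using s[of "(i + k) mod m"] m by (simp add: mod_Suc_eq)
      then show ?case using Suc A(3) by fastforce
    qed
    \<comment> \<open>Going \<open>j + m - i\<close> steps from \<open>i\<close> reaches
      \<open>j\<close>; the added \<open>m\<close> keeps the subtraction from being cut off at
      zero.\<close>
    have "vs ! j \<in> A" if "j < m" for j
      using iter[of "j + m - i"] that i(1) by simp
    then show ?thesis using A(1) ex by blast
  qed
  show thesis
  proof (rule that)
    show "cyclic_succ G s" unfolding cyclic_succ_def using bs step ss cl by blast
    show "\<exists>vs. is_cycle G vs \<and> set vs = verts G \<and> last vs = u \<and> hd vs = s u"
      if "u \<in> verts G" for u using ex[OF that] rot by blast
  qed
qed

lemma cyclic_succ_pred:
  assumes "cyclic_succ G s" "u \<in> verts G"
  obtains p where "p \<in> verts G" "s p = u" "{u, p} \<in> edges G" "p \<noteq> s u"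
proof -
  obtain p where p: "p \<in> verts G" "s p = u"
    using assms unfolding cyclic_succ_def bij_betw_def by (metis imageE)
  then have "{p, s p} \<in> edges G" "p \<noteq> s u" using assms unfolding cyclic_succ_def by auto
  then show thesis using that p by (simp add: insert_commute)
qed


section \<open>Simple graphs and hypohamiltonian graphs\<close>

lemma simple_graph_finite_edges: "simple_graph G \<Longrightarrow> finite (edges G)"
  unfolding simple_graph_def by (rule finite_subset[of _ "Pow (verts G)"]) auto

lemma simple_graph_edge:
  assumes "simple_graph G" "{u, v} \<in> edges G"
  shows "u \<in> verts G" "v \<in> verts G" "u \<noteq> v"
  using assms unfolding simple_graph_def by fastforce+

lemma simple_graph_edgeE:
  assumes "simple_graph G" "e \<in> edges G" "v \<in> e"
  obtains w where "e = {v, w}" "v \<noteq> w"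
proof -
  have "card e = 2" using assms unfolding simple_graph_def by blast
  then obtain a b where "e = {a, b}" "a \<noteq> b" by (auto simp: card_2_iff)
  then show thesis using that[of a] that[of b] assms(3) by auto
qed

lemma simple_graph_induced: "simple_graph G \<Longrightarrow> simple_graph (induced G S)"
  unfolding simple_graph_def induced_def by auto

lemma simple_graph_add_edge: "simple_graph G \<Longrightarrow> e \<in> nonedges G \<Longrightarrow> simple_graph (add_edge G e)"
  unfolding simple_graph_def add_edge_def nonedges_def by auto

lemma degree_mono:
  assumes "simple_graph G" "edges K \<subseteq> edges G"
  shows "degree K v \<le> degree G v"
  unfolding degree_def using simple_graph_finite_edges[OF assms(1)] assms(2)
  by (intro card_mono) auto

lemma edge_nonedge_if_degree_less:
  assumes "simple_graph G" "verts K = verts G" "edges K \<subseteq> edges G" "degree K v < degree G v"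
  shows "\<exists>e\<in>{e \<in> nonedges K. v \<in> e}. e \<in> edges G"
proof (rule ccontr)
  assume "\<not> ?thesis"
  then have "{e \<in> edges G. v \<in> e} = {e \<in> edges K. v \<in> e}"
    using assms(1-3) unfolding nonedges_def simple_graph_def by auto
  then show False using assms(4) unfolding degree_def by simp
qed

lemma card_neighbours_le_degree:
  assumes "simple_graph G" "\<And>x. x \<in> A \<Longrightarrow> {v, x} \<in> edges G"
  shows "card A \<le> degree G v"
  unfolding degree_def
proof (rule card_inj_on_le[of "\<lambda>x. {v, x}"])
  show "inj_on (\<lambda>x. {v, x}) A" by (auto simp: inj_on_def doubleton_eq_iff)
qed (use assms simple_graph_finite_edges[OF assms(1)] in auto)

lemma card_two_le: "a \<in> A \<Longrightarrow> b \<in> A \<Longrightarrow> a \<noteq> b \<Longrightarrow> finite A \<Longrightarrow> 2 \<le> card A"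
  by (metis card_2_iff card_mono empty_subsetI insert_subset)

text \<open>Deleting any other vertex \<open>w\<close> leaves \<open>v\<close> on a cycle, hence
  with two neighbours besides \<open>w\<close>. Once this has produced a neighbour \<open>a\<close>,
  taking \<open>w = a\<close> gives two more.\<close>

lemma hypohamiltonian_degree_ge_3:
  assumes G: "simple_graph G" "hypohamiltonian G" and n: "card (verts G) \<ge> 2" and v: "v \<in> verts G"
  shows "degree G v \<ge> 3"
proof -
  have two: "\<exists>a b. a \<noteq> b \<and> {v, a} \<in> edges G \<and> {v, b} \<in> edges G \<and> a \<noteq> w \<and> b \<noteq> w"
    if w: "w \<in> verts G" "w \<noteq> v" for w
  proof -
    obtain s where s: "cyclic_succ (remove_verts G {w}) s"
      using G(2) w(1) unfolding hypohamiltonian_def by (metis hamiltonian_cyclic_succ)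
    have v': "v \<in> verts (remove_verts G {w})" using v w by (auto simp: remove_verts_def induced_def)
    obtain p where "{v, p} \<in> edges (remove_verts G {w})" "p \<noteq> s v"
      using cyclic_succ_pred[OF s v'] by metis
    moreover have "{v, s v} \<in> edges (remove_verts G {w})" using s v' by (auto simp: cyclic_succ_def)
    ultimately show ?thesis by (intro exI[of _ p] exI[of _ "s v"]) (auto simp: remove_verts_def induced_def)
  qed
  have "\<exists>w\<in>verts G. w \<noteq> v"
  proof (rule ccontr)
    assume "\<not> ?thesis"
    then have "verts G \<subseteq> {v}" by blast
    then have "card (verts G) \<le> 1" using card_mono[of "{v}" "verts G"] by simp
    then show False using n by simp
  qed
  then obtain a where a: "{v, a} \<in> edges G" using two by blast
  then have "a \<in> verts G" "a \<noteq> v" using simple_graph_edge[OF G(1) a] by auto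
  then obtain b c where bc: "b \<noteq> c" "{v, b} \<in> edges G" "{v, c} \<in> edges G" "b \<noteq> a" "c \<noteq> a"
    using two by blast
  have "card {a, b, c} \<le> degree G v"
    using a bc by (intro card_neighbours_le_degree[OF G(1)]) auto
  then show ?thesis using bc by simp
qed

text \<open>A hamiltonian cycle of \<open>G - u\<close> would have to use the edge \<open>v w\<close> of the triangle, and \<open>u\<close>
  could be inserted there.\<close>

lemma hypohamiltonian_degree_3_no_triangle:
  assumes G: "simple_graph G" "hypohamiltonian G" and v: "degree G v = 3"
    and tri: "{u, v} \<in> edges G" "{v, w} \<in> edges G" "{u, w} \<in> edges G"
  shows False
proof -
  let ?R = "remove_verts G {u}"
  note ne = simple_graph_edge[OF G(1) tri(1)] simple_graph_edge[OF G(1) tri(2)]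
    simple_graph_edge[OF G(1) tri(3)]
  have VR: "verts ?R = verts G - {u}" by (auto simp: remove_verts_def induced_def)
  have ER: "e \<in> edges G \<and> u \<notin> e" if "e \<in> edges ?R" for e
    using that by (auto simp: remove_verts_def induced_def)
  obtain s where s: "cyclic_succ ?R s"
    "\<And>x. x \<in> verts ?R \<Longrightarrow> \<exists>vs. is_cycle ?R vs \<and> set vs = verts ?R \<and> last vs = x \<and> hd vs = s x"
    using G(2) ne(1) hamiltonian_cyclic_succ[of ?R] unfolding hypohamiltonian_def by metis
  have v': "v \<in> verts ?R" and w': "w \<in> verts ?R" using ne VR by auto
  obtain p where p: "p \<in> verts ?R" "s p = v" "{v, p} \<in> edges ?R" "p \<noteq> s v"
    using cyclic_succ_pred[OF s(1) v'] by metis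
  have sv: "{v, s v} \<in> edges ?R" using s(1) v' unfolding cyclic_succ_def by blast
  \<comment> \<open>In \<open>G - u\<close> only two neighbours of \<open>v\<close> remain, one of
    them \<open>w\<close>. If the cycle did not join \<open>v\<close> to \<open>w\<close>, then
    \<open>u\<close>, \<open>w\<close>, \<open>p\<close> and \<open>s v\<close> would be four
    neighbours of \<open>v\<close>.\<close>
  have "s v = w \<or> p = w"
  proof (rule ccontr)
    assume *: "\<not> ?thesis"
    have "card {u, w, p, s v} \<le> degree G v"
      using tri ER[OF p(3)] ER[OF sv]
      by (intro card_neighbours_le_degree[OF G(1)]) (auto simp: insert_commute)
    moreover have "p \<noteq> u" "s v \<noteq> u" using ER[OF p(3)] ER[OF sv] by auto
    then have "card {u, w, p, s v} = 4" using * p(4) ne by auto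
    ultimately show False using v by simp
  qed
  \<comment> \<open>Rotate the cycle to end in \<open>v\<close> if \<open>w\<close> follows
    \<open>v\<close>, and to end in \<open>w\<close> if \<open>w\<close> precedes
    \<open>v\<close>.\<close>
  then obtain vs where vs: "is_cycle ?R vs" "set vs = verts ?R" "{last vs, hd vs} = {v, w}"
    using s(2)[OF v'] s(2)[OF w'] p(2) by (metis insert_commute)
  have u: "{u, last vs} \<in> edges G" "{u, hd vs} \<in> edges G"
    using vs(3) tri by (auto simp: doubleton_eq_iff insert_commute)
  have succ: "successively (\<lambda>a b. {a, b} \<in> edges G) vs"
    using vs(1) ER unfolding is_cycle_def is_path_def
    by (auto elim!: successively_mono)
  obtain x xs where x: "vs = x # xs" using vs(1) unfolding is_cycle_def is_path_def by (cases vs) auto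
  have "is_cycle G (u # vs)"
    using vs(1,2) u succ ne(1) VR x unfolding is_cycle_def is_path_def
    by (auto simp: insert_commute)
  moreover have "set (u # vs) = verts G" using vs(2) VR ne(1) by auto
  ultimately show False using G(2) unfolding hypohamiltonian_def hamiltonian_def by blast
qed


section \<open>Leaving one side of a partition along a hamiltonian cycle\<close>

text \<open>In the applications \<open>Y\<close> is \<open>X\<close> without the deleted vertex, so
  that \<open>card_exits_le\<close> yields fewer than |X| exits.\<close>

locale cycle_split =
  fixes G :: "'a ugraph" and W Y :: "'a set" and s :: "'a \<Rightarrow> 'a"
  assumes simple: "simple_graph G"
    and sub: "W \<union> Y \<subseteq> verts G" and disj: "W \<inter> Y = {}" and nonempty: "Y \<noteq> {}"
    and cyclic: "cyclic_succ (induced G (W \<union> Y)) s"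
begin

definition exits :: "'a set" where
  "exits = {u \<in> W. s u \<in> Y}"

text \<open>These sets are the unions of components of \<open>G[W]\<close>, described without
  connectivity. The cycle can leave such a set only into \<open>Y\<close>.\<close>

definition closed_in_W :: "'a set \<Rightarrow> bool" where
  "closed_in_W C \<longleftrightarrow> C \<subseteq> W \<and> (\<forall>u\<in>C. \<forall>w\<in>W. {u, w} \<in> edges G \<longrightarrow> w \<in> C)"

lemma fin: "finite W" "finite Y"
  using simple sub finite_subset unfolding simple_graph_def by auto

lemma verts_eq: "verts (induced G (W \<union> Y)) = W \<union> Y"
  using sub by (auto simp: induced_def)

lemma bij_succ: "bij_betw s (W \<union> Y) (W \<union> Y)"
  using cyclic verts_eq unfolding cyclic_succ_def by simp

lemma inj_succ: "inj_on s (W \<union> Y)"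
  using bij_succ by (rule bij_betw_imp_inj_on)

lemma succ_mem: "u \<in> W \<union> Y \<Longrightarrow> s u \<in> W \<union> Y"
  using bij_succ bij_betwE by blast

lemma succ_edge: "u \<in> W \<union> Y \<Longrightarrow> {u, s u} \<in> edges G"
  using cyclic verts_eq unfolding cyclic_succ_def induced_def by auto

lemma succ_succ: "u \<in> W \<union> Y \<Longrightarrow> s (s u) \<noteq> u"
  using cyclic unfolding cyclic_succ_def verts_eq by simp

lemma predE:
  assumes "u \<in> W \<union> Y"
  obtains p where "p \<in> W \<union> Y" "s p = u" "{u, p} \<in> edges G" "p \<noteq> s u"
  using cyclic_succ_pred[OF cyclic, of u] assms verts_eq by (auto simp: induced_def)

lemma invariant_eq: "A \<subseteq> W \<union> Y \<Longrightarrow> A \<noteq> {} \<Longrightarrow> s ` A \<subseteq> A \<Longrightarrow> A = W \<union> Y"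
  using cyclic unfolding cyclic_succ_def verts_eq by simp

lemma card_exits_le: "card exits \<le> card Y"
  by (rule card_inj_on_le[of s])
    (use fin in \<open>auto simp: exits_def intro: inj_on_subset[OF inj_succ]\<close>)

lemma finite_exits: "finite exits"
  using fin unfolding exits_def by simp

text \<open>A single orbit leaves every proper nonempty part, and \<open>C\<close> is proper because
  \<open>Y\<close> is nonempty. The vertex reached lies in \<open>Y\<close>, since \<open>C\<close>
  has no edges to the rest of \<open>W\<close>.\<close>

lemma closed_exit:
  assumes "closed_in_W C" "C \<noteq> {}"
  shows "\<exists>u\<in>C. u \<in> exits"
proof -
  have CW: "C \<subseteq> W" using assms unfolding closed_in_W_def by blast
  then have "C \<noteq> W \<union> Y" using disj nonempty by blast
  then have "\<not> s ` C \<subseteq> C" using invariant_eq[of C] assms(2) CW by auto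
  then obtain u where u: "u \<in> C" "s u \<notin> C" by blast
  then have "s u \<in> W \<union> Y" "{u, s u} \<in> edges G" using succ_edge[of u] succ_mem[of u] CW by auto
  then have "s u \<in> Y" using assms(1) u unfolding closed_in_W_def by blast
  then show ?thesis using u CW unfolding exits_def by blast
qed

lemma card_closed_family_le:
  assumes closed: "\<And>C. C \<in> F \<Longrightarrow> closed_in_W C \<and> C \<noteq> {}"
    and dis: "\<And>C D. C \<in> F \<Longrightarrow> D \<in> F \<Longrightarrow> C \<noteq> D \<Longrightarrow> C \<inter> D = {}"
  shows "card F \<le> card (exits \<inter> \<Union>F)"
proof -
  have "\<forall>C\<in>F. \<exists>u. u \<in> C \<and> u \<in> exits" using closed closed_exit by blast
  then obtain f where f: "\<And>C. C \<in> F \<Longrightarrow> f C \<in> C \<and> f C \<in> exits" by metis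
  show ?thesis
  proof (rule card_inj_on_le[of f])
    show "inj_on f F" using f dis by (intro inj_onI) (metis IntI empty_iff)
    show "f ` F \<subseteq> exits \<inter> \<Union>F" using f by blast
    show "finite (exits \<inter> \<Union>F)" using finite_exits by simp
  qed
qed

lemma closed_in_W_sym:
  assumes "closed_in_W C" "u \<in> W" "u \<notin> C" "w \<in> C"
  shows "{u, w} \<notin> edges G"
  using assms unfolding closed_in_W_def by (metis insert_commute)

text \<open>Of the |R| arcs of the cycle ending in \<open>R\<close> and the |R| arcs starting there,
  discard those inside \<open>R\<close> (counted by \<open>?M\<close>). What remains comes from
  \<open>Y\<close> and goes to \<open>Y\<close> respectively, as \<open>R\<close> is closed.\<close>

lemma card_entries:
  assumes "closed_in_W R"
  shows "card {y \<in> Y. s y \<in> R} = card (exits \<inter> R)"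
proof -
  have RW: "R \<subseteq> W" using assms unfolding closed_in_W_def by blast
  let ?P = "{u \<in> W \<union> Y. s u \<in> R}" and ?M = "{u \<in> R. s u \<in> R}"
  have finR: "finite R" using RW fin finite_subset by blast
  have "s ` ?P = R"
  proof
    show "R \<subseteq> s ` ?P"
    proof
      fix r assume r: "r \<in> R"
      then obtain p where "p \<in> W \<union> Y" "s p = r" using predE[of r] RW by blast
      then show "r \<in> s ` ?P" using r by blast
    qed
  qed auto
  then have "card ?P = card R" using card_image[of s ?P] inj_on_subset[OF inj_succ, of ?P] by fastforce
  moreover have P: "?P = ?M \<union> {y \<in> Y. s y \<in> R}"
  proof -
    have "u \<in> R" if "u \<in> W" "s u \<in> R" for u
      using closed_in_W_sym[OF assms that(1) _ that(2)] succ_edge[of u] that(1) by blast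
    then show ?thesis using RW by blast
  qed
  have "card ?P = card ?M + card {y \<in> Y. s y \<in> R}"
    unfolding P using finR fin disj RW by (intro card_Un_disjoint) auto
  moreover have "R = ?M \<union> (exits \<inter> R)"
  proof -
    have "s u \<in> R \<or> s u \<in> Y" if "u \<in> R" for u
      using assms succ_edge[of u] succ_mem[of u] that unfolding closed_in_W_def by blast
    then show ?thesis using RW unfolding exits_def by blast
  qed
  then have "card R = card ?M + card (exits \<inter> R)"
    using finR disj RW by (subst card_Un_disjoint[symmetric]) (auto simp: exits_def)
  ultimately show ?thesis by simp
qed

end

text \<open>Deleting a vertex of \<open>X\<close> keeps \<open>W\<close> intact and lowers the
  number of possible exits by one; |X| > 1 leaves something to exit to.\<close>

lemma hypohamiltonian_cycle_split:
  assumes G: "simple_graph G" "hypohamiltonian G" and V: "W \<union> X = verts G" "W \<inter> X = {}"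
    and x: "x \<in> X" "card X > 1"
  obtains s where "cycle_split G W (X - {x}) s"
proof -
  have "x \<in> verts G" using V x by blast
  then obtain s where s: "cyclic_succ (remove_verts G {x}) s"
    using G(2) unfolding hypohamiltonian_def by (metis hamiltonian_cyclic_succ)
  have "remove_verts G {x} = induced G (W \<union> (X - {x}))"
    unfolding remove_verts_def using V x by (intro arg_cong[of _ _ "induced G"]) auto
  moreover have "X - {x} \<noteq> {}"
    using x by (metis card.empty card_Suc_Diff1 card.infinite not_one_less_zero less_irrefl One_nat_def)
  ultimately have "cycle_split G W (X - {x}) s" using assms s by unfold_locales auto
  then show thesis by (rule that)
qed


section \<open>Obstructions\<close>

lemma component_self: "u \<in> verts G \<Longrightarrow> u \<in> component G u"
  unfolding component_def by simp

lemma component_eq: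
  assumes "w \<in> component G u"
  shows "component G w = component G u"
proof -
  let ?r = "\<lambda>x y. {x, y} \<in> edges G"
  have uw: "?r\<^sup>*\<^sup>* u w" using assms unfolding component_def by simp
  have sym: "?r\<^sup>*\<^sup>* w u" if "?r\<^sup>*\<^sup>* u w" for u w
    using that
  proof (induction rule: rtranclp_induct)
    case (step y z)
    then have "{z, y} \<in> edges G" by (simp add: insert_commute)
    then show ?case using step.IH by (rule converse_rtranclp_into_rtranclp)
  qed simp
  have "?r\<^sup>*\<^sup>* w v \<longleftrightarrow> ?r\<^sup>*\<^sup>* u v" for v
    using rtranclp_trans[OF uw, of v] rtranclp_trans[OF sym[OF uw], of v] by blast
  then show ?thesis unfolding component_def by simp
qed

lemma components_disjoint:
  assumes "C \<in> components G" "D \<in> components G" "C \<noteq> D"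
  shows "C \<inter> D = {}"
proof (rule ccontr)
  assume "C \<inter> D \<noteq> {}"
  then obtain v where v: "v \<in> C" "v \<in> D" by blast
  obtain x y where "C = component G x" "D = component G y"
    using assms(1,2) unfolding components_def by blast
  then show False using v component_eq[of v G x] component_eq[of v G y] assms(3) by simp
qed

lemma components_edge_closed:
  assumes "C \<in> components G" "u \<in> C" "{u, w} \<in> edges G" "w \<in> verts G"
  shows "w \<in> C"
proof -
  have "(\<lambda>x y. {x, y} \<in> edges G)\<^sup>*\<^sup>* u w" using assms(3) by blast
  then have "w \<in> component G u" using assms(4) unfolding component_def by simp
  moreover obtain z where "C = component G z" using assms(1) unfolding components_def by blast
  ultimately show ?thesis using component_eq[of u G z] assms(2) by simp
qed

lemma components_subset: "C \<in> components G \<Longrightarrow> C \<subseteq> verts G"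
  unfolding components_def component_def by auto

lemma components_nonempty: "C \<in> components G \<Longrightarrow> C \<noteq> {}"
  unfolding components_def using component_self[of _ G] by blast

lemma mem_components: "v \<in> verts G \<Longrightarrow> \<exists>C\<in>components G. v \<in> C"
  unfolding components_def using component_self[of v G] by blast

text \<open>Traversing each component once is a path cover. Exits are counted per component, so this
  is the direction that turns a large \<open>p_num\<close> into many exits.\<close>

lemma p_num_le_card_components:
  assumes fin: "finite (verts H)" and paths: "union_of_disjoint_paths H"
  shows "p_num H \<le> card (components H)"
proof -
  have "\<exists>vs. is_path H vs \<and> set vs = C" if C: "C \<in> components H" for C
  proof -
    obtain vs where vs: "vs \<noteq> []" "distinct vs" "verts (induced H C) = set vs"
      "edges (induced H C) = {{vs ! i, vs ! Suc i} | i. Suc i < length vs}"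
      using paths C unfolding union_of_disjoint_paths_def path_graph_def by blast
    have "set vs = C" using vs(3) components_subset[OF C] unfolding induced_def by auto
    moreover have "{vs ! i, vs ! Suc i} \<in> edges H" if "Suc i < length vs" for i
      using vs(4) that unfolding induced_def by auto
    ultimately have "is_path H vs" using vs(1,2) components_subset[OF C]
      unfolding is_path_def by (auto simp: successively_conv_nth)
    then show ?thesis using \<open>set vs = C\<close> by blast
  qed
  then obtain f where f: "\<And>C. C \<in> components H \<Longrightarrow> is_path H (f C) \<and> set (f C) = C" by metis
  have finc: "finite (components H)" using fin unfolding components_def by simp
  have "path_cover H (f ` components H)"
    unfolding path_cover_def
  proof (intro conjI ballI impI)
    show "(\<Union>vs\<in>f ` components H. set vs) = verts H"
      using f components_subset[of _ H] mem_components[of _ H] by (auto; blast)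
    fix vs ws assume "vs \<in> f ` components H" "ws \<in> f ` components H" "vs \<noteq> ws"
    then obtain C D where "C \<in> components H" "D \<in> components H" "vs = f C" "ws = f D" "C \<noteq> D"
      by blast
    then show "set vs \<inter> set ws = {}" using f components_disjoint[of C H D] by simp
  qed (use f finc in auto)
  then have "p_num H \<le> card (f ` components H)" unfolding p_num_def by (metis (mono_tags, lifting) Least_le)
  then show ?thesis using card_image_le[OF finc, of f] by simp
qed

text \<open>Without a good edge in \<open>G\<close>, the components of \<open>K[W]\<close> stay
  closed in \<open>G[W]\<close>, so each of them has its own exit. Then |X| <= p <= number of
  components <= number of exits <= |X| - 1.\<close>

lemma type_A_good_edge:
  assumes G: "simple_graph G" "hypohamiltonian G" and K: "verts K = verts G" "edges K \<subseteq> edges G"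
    and A: "type_A K W X"
  shows "\<exists>e\<in>good_A K W. e \<in> edges G"
proof (rule ccontr)
  assume no: "\<not> ?thesis"
  have V: "W \<union> X = verts G" "W \<inter> X = {}" "card X > 1"
    using A K unfolding type_A_def two_partition_def by auto
  then obtain x where x: "x \<in> X" by fastforce
  obtain s where "cycle_split G W (X - {x}) s"
    using hypohamiltonian_cycle_split[OF G V(1,2) x V(3)] .
  then interpret cycle_split G W "X - {x}" s .
  let ?H = "induced K W"
  have VH: "verts ?H = W" using V K by (auto simp: induced_def)
  have cl: "closed_in_W C" if C: "C \<in> components ?H" for C
    unfolding closed_in_W_def
  proof (intro conjI ballI impI)
    show CW: "C \<subseteq> W" using components_subset[OF C] VH by simp
    fix u w assume uw: "u \<in> C" "w \<in> W" "{u, w} \<in> edges G"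
    obtain D where D: "D \<in> components ?H" "w \<in> D" using mem_components VH uw(2) by metis
    have "{u, w} \<in> nonedges K \<or> {u, w} \<in> edges ?H"
      using uw CW K(1) G(1) unfolding nonedges_def induced_def simple_graph_def by auto
    then show "w \<in> C"
    proof
      assume "{u, w} \<in> nonedges K"
      then have "C = D" using no C D uw(1,3) unfolding good_A_def by blast
      then show ?thesis using D by simp
    next
      assume "{u, w} \<in> edges ?H"
      then show ?thesis using components_edge_closed[OF C uw(1)] uw(2) VH by simp
    qed
  qed
  have "card (components ?H) \<le> card (exits \<inter> \<Union>(components ?H))"
  proof (rule card_closed_family_le)
    show "closed_in_W C \<and> C \<noteq> {}" if "C \<in> components ?H" for C
      using cl[OF that] components_nonempty[OF that] by simp
  qed (rule components_disjoint)
  also have "\<dots> \<le> card exits" using finite_exits by (intro card_mono) auto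
  also have "\<dots> \<le> card (X - {x})" by (rule card_exits_le)
  also have "\<dots> < card X" using x V(3) card.infinite by (intro card_Diff1_less) fastforce
  finally have "card (components ?H) < card X" .
  moreover have "p_num ?H \<le> card (components ?H)"
    using A fin VH by (intro p_num_le_card_components) (auto simp: type_A_def)
  ultimately show False using A unfolding type_A_def by simp
qed

text \<open>If \<open>G\<close> contains no good \<open>B\<close>-edge of \<open>K\<close>, the vertices of degree at most one in \<open>K[W]\<close> have
  the same neighbours in \<open>G[W]\<close>. So the isolated components counted by \<open>k\<close> are left by the cycle
  at least once each, and the cycle passes from every other vertex of degree one directly into \<open>Y\<close>
  or arrives from there.\<close>

lemma (in cycle_split) k_num_le_card_exits:
  assumes K: "verts K = verts G" "edges K \<subseteq> edges G"
    and no: "\<And>e. e \<in> good_B K W \<Longrightarrow> e \<notin> edges G"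
    and U: "closed_in_W U"
  shows "k_num (induced K U) \<le> card (exits \<inter> U)"
  using U
\<comment> \<open>\<open>k_num\<close> recurses on what is left after removing the isolated
  components, and that set is again closed; hence the claim for all closed \<open>U\<close> instead
  of \<open>W\<close>.\<close>
proof (induction "card U" arbitrary: U rule: less_induct)
  case less
  let ?H = "induced K U"
  note cl = less.prems
  have UW: "U \<subseteq> W" using cl unfolding closed_in_W_def by blast
  then have finU: "finite U" and VH: "verts ?H = U"
    using fin sub K finite_subset by (auto simp: induced_def)
  have simpK: "simple_graph K" using simple K unfolding simple_graph_def by auto
  \<comment> \<open>Good edges are defined by degrees in \<open>K[W]\<close>, but
    \<open>k_num\<close> sees \<open>K[U]\<close>; closedness of \<open>U\<close> makes the two
    agree.\<close>
  have deg: "degree (induced K W) u = degree ?H u" if u: "u \<in> U" for u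
  proof -
    have "e \<subseteq> U" if e: "e \<in> edges K" "e \<subseteq> W" "u \<in> e" for e
    proof -
      obtain w where "e = {u, w}" using simple_graph_edgeE[OF simpK e(1,3)] by blast
      then show ?thesis using cl u e K(2) unfolding closed_in_W_def by blast
    qed
    then have "{e \<in> edges (induced K W). u \<in> e} = {e \<in> edges ?H. u \<in> e}"
      using UW unfolding induced_def by auto
    then show ?thesis unfolding degree_def by simp
  qed
  have low: "{u, w} \<in> edges ?H"
    if u: "u \<in> U" "degree ?H u \<le> 1" and w: "w \<in> W" "{u, w} \<in> edges G" for u w
  proof -
    have "w \<in> U" using cl u w unfolding closed_in_W_def by blast
    moreover have "{u, w} \<in> edges K"
    proof (rule ccontr)
      assume "{u, w} \<notin> edges K"
      then have "{u, w} \<in> nonedges K" using w(2) simple K(1) unfolding nonedges_def simple_graph_def by auto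
      then have "{u, w} \<in> good_B K W" using u w UW deg[OF u(1)] unfolding good_B_def by auto
      then show False using no w by blast
    qed
    ultimately show ?thesis using u unfolding induced_def by simp
  qed
  let ?I = "I_comps ?H"
  show ?case
  proof (cases "U = {} \<or> ?I \<noteq> {}")
    case False
    then have k: "k_num ?H = max 1 (nat \<lceil>real (card (V1 ?H)) / 2\<rceil>)"
      using finU VH by (subst k_num.simps) simp
    let ?N = "{y \<in> Y. s y \<in> U}"
    have "V1 ?H \<subseteq> (exits \<inter> U) \<union> s ` ?N"
    proof
      fix v assume "v \<in> V1 ?H"
      then have v: "v \<in> U" "degree ?H v = 1" using VH unfolding V1_def by auto
      obtain p where p: "p \<in> W \<union> Y" "s p = v" "{v, p} \<in> edges G" "p \<noteq> s v"
        using predE[of v] v UW by blast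
      have "s v \<in> Y \<or> p \<in> Y"
      proof (rule ccontr)
        assume *: "\<not> ?thesis"
        have "s v \<in> W" "{v, s v} \<in> edges G" using * succ_mem[of v] succ_edge[of v] v UW by auto
        then have "{v, s v} \<in> edges ?H" "{v, p} \<in> edges ?H" using low[OF v(1)] v(2) p * by auto
        then have "card {s v, p} \<le> degree ?H v"
          by (intro card_neighbours_le_degree simple_graph_induced simpK) auto
        then show False using v(2) p(4) by simp
      qed
      then show "v \<in> (exits \<inter> U) \<union> s ` ?N" using v p UW unfolding exits_def by blast
    qed
    then have "card (V1 ?H) \<le> card ((exits \<inter> U) \<union> s ` ?N)"
      using finite_exits fin by (intro card_mono) auto
    also have "\<dots> \<le> card (exits \<inter> U) + card (s ` ?N)" by (rule card_Un_le)
    also have "card (s ` ?N) \<le> card ?N" using fin by (intro card_image_le) simp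
    \<comment> \<open>Entries and exits are equally many: this accounts for the halving of |V1| in
      \<open>k_num\<close>.\<close>
    also have "card ?N = card (exits \<inter> U)" by (rule card_entries[OF cl])
    finally have "card (V1 ?H) \<le> 2 * card (exits \<inter> U)" by simp
    \<comment> \<open>The lower bound 1 in \<open>k_num\<close> is the one exit that every nonempty
      closed set has.\<close>
    moreover have "card (exits \<inter> U) \<noteq> 0"
      using closed_exit[OF cl] False finite_exits by auto
    ultimately show ?thesis unfolding k by (simp add: ceiling_le_iff)
  next
    case True
    show ?thesis
    proof (cases "U = {}")
      case True
      then show ?thesis using VH by (subst k_num.simps) simp
    next
      case Une: False
      then have Ine: "?I \<noteq> {}" using True by blast
      have comp: "C \<in> components ?H" if "C \<in> ?I" for C using that unfolding I_comps_def by blast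
      \<comment> \<open>In an isolated vertex or \<open>K2\<close> every edge of \<open>?H\<close>
        at \<open>u\<close> is the whole component \<open>C\<close>, so \<open>u\<close> has degree
        at most one. By \<open>low\<close>, \<open>G\<close> then adds no edge from \<open>u\<close>
        to the rest of \<open>W\<close>.\<close>
      have clI: "closed_in_W C" if C: "C \<in> ?I" for C
        unfolding closed_in_W_def
      proof (intro conjI ballI impI)
        show "C \<subseteq> W" using components_subset[OF comp[OF C]] VH UW by simp
        fix u w assume uw: "u \<in> C" "w \<in> W" "{u, w} \<in> edges G"
        have u: "u \<in> U" using components_subset[OF comp[OF C]] uw VH by blast
        have "e = C" if e: "e \<in> edges ?H" "u \<in> e" for e
        proof -
          obtain z where z: "e = {u, z}" "u \<noteq> z"
            using simple_graph_edgeE[OF simple_graph_induced[OF simpK] e] by blast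
          then have "z \<in> U" using e(1) unfolding induced_def by auto
          then have "z \<in> C" using components_edge_closed[OF comp[OF C] uw(1)] z e(1) VH by auto
          moreover have "(\<exists>v. C = {v}) \<or> card C = 2"
            using C simple_graph_induced[OF simpK, of U] unfolding I_comps_def simple_graph_def by auto
          ultimately show ?thesis using z uw(1) by (auto simp: card_2_iff)
        qed
        then have "{e \<in> edges ?H. u \<in> e} \<subseteq> {C}" by blast
        then have "degree ?H u \<le> 1" unfolding degree_def using card_mono[of "{C}"] by fastforce
        then have "{u, w} \<in> edges ?H" using low u uw by blast
        moreover from this have "w \<in> verts ?H" using simple_graph_edge[OF simple_graph_induced[OF simpK]] by blast
        ultimately show "w \<in> C" using components_edge_closed[OF comp[OF C] uw(1)] by blast
      qed
      let ?U = "U - \<Union>?I"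
      have IU: "\<Union>?I \<subseteq> U" using components_subset comp VH by blast
      have cardI: "card ?I \<le> card (exits \<inter> \<Union>?I)"
      proof (rule card_closed_family_le)
        show "closed_in_W C \<and> C \<noteq> {}" if "C \<in> ?I" for C
          using clI[OF that] components_nonempty[OF comp[OF that]] by simp
        show "C \<inter> D = {}" if "C \<in> ?I" "D \<in> ?I" "C \<noteq> D" for C D
          by (rule components_disjoint[OF comp[OF that(1)] comp[OF that(2)] that(3)])
      qed
      have clU: "closed_in_W ?U"
        unfolding closed_in_W_def
      proof (intro conjI ballI impI)
        show "?U \<subseteq> W" using UW by blast
        fix u w assume uw: "u \<in> ?U" "w \<in> W" "{u, w} \<in> edges G"
        have "w \<notin> C" if C: "C \<in> ?I" for C
        proof
          assume "w \<in> C"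
          moreover have "{w, u} \<in> edges G" using uw by (simp add: insert_commute)
          ultimately show False using clI[OF C] uw(1) UW C unfolding closed_in_W_def by blast
        qed
        then show "w \<in> ?U" using cl uw unfolding closed_in_W_def by blast
      qed
      obtain C where C: "C \<in> ?I" using Ine by blast
      then have "?U \<subset> U" using IU components_nonempty[OF comp[OF C]] by blast
      then have "card ?U < card U" using finU by (rule psubset_card_mono[rotated])
      then have IH: "k_num (induced K ?U) \<le> card (exits \<inter> ?U)" using less.hyps clU by blast
      have "remove_verts ?H (\<Union>?I) = induced K ?U"
        unfolding remove_verts_def VH unfolding induced_def using UW sub K(1) by auto
      then have "k_num ?H = card ?I + k_num (induced K ?U)"
        using finU VH Une Ine by (subst k_num.simps) simp
      also have "\<dots> \<le> card (exits \<inter> \<Union>?I) + card (exits \<inter> ?U)" using cardI IH by simp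
      also have "\<dots> = card ((exits \<inter> \<Union>?I) \<union> (exits \<inter> ?U))"
        using finite_exits by (intro card_Un_disjoint[symmetric]) auto
      also have "(exits \<inter> \<Union>?I) \<union> (exits \<inter> ?U) = exits \<inter> U" using IU by blast
      finally show ?thesis .
    qed
  qed
qed

text \<open>The case \<open>U = W\<close> of the preceding bound: k <= number of exits <= |X| -
  1.\<close>

lemma type_B_good_edge:
  assumes G: "simple_graph G" "hypohamiltonian G" and K: "verts K = verts G" "edges K \<subseteq> edges G"
    and B: "type_B K W X"
  shows "\<exists>e\<in>good_B K W. e \<in> edges G"
proof (rule ccontr)
  assume no: "\<not> ?thesis"
  have V: "W \<union> X = verts G" "W \<inter> X = {}" "card X > 1"
    using B K unfolding type_B_def two_partition_def by auto
  then obtain x where x: "x \<in> X" by fastforce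
  obtain s where "cycle_split G W (X - {x}) s"
    using hypohamiltonian_cycle_split[OF G V(1,2) x V(3)] .
  then interpret cycle_split G W "X - {x}" s .
  have "k_num (induced K W) \<le> card (exits \<inter> W)"
    using no by (intro k_num_le_card_exits[OF K]) (auto simp: closed_in_W_def)
  also have "\<dots> \<le> card exits" using finite_exits by (intro card_mono) auto
  also have "\<dots> \<le> card (X - {x})" by (rule card_exits_le)
  also have "\<dots> < card X" using x V(3) card.infinite by (intro card_Diff1_less) fastforce
  finally show False using B unfolding type_B_def by simp
qed

text \<open>The cycle of \<open>G - v\<close> has \<open>2 |W|\<close> edges between \<open>W\<close> and \<open>X - v\<close>, at most two of them at each
  vertex of \<open>X - v\<close>.\<close>

lemma type_C_good_edge:
  assumes G: "simple_graph G" "hypohamiltonian G" and K: "verts K = verts G" "edges K \<subseteq> edges G"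
    and C: "type_C K W X v"
  shows "\<exists>e\<in>good_C K W X v. e \<in> edges G"
proof (rule ccontr)
  assume no: "\<not> ?thesis"
  have V: "W \<union> X = verts G" "W \<inter> X = {}" "card X > 1" "v \<in> X"
    using C K unfolding type_C_def two_partition_def by auto
  obtain s where "cycle_split G W (X - {v}) s"
    using hypohamiltonian_cycle_split[OF G V(1,2,4,3)] .
  then interpret cycle_split G W "X - {v}" s .
  let ?Y = "X - {v}"
  \<comment> \<open>The two kinds of good edges give two facts: \<open>W\<close> stays independent
    in \<open>G\<close>, and a vertex of \<open>X - v\<close> with at most one neighbour in
    \<open>W\<close> gains none in \<open>G\<close>.\<close>
  have indep: "{u, w} \<notin> edges G" if uw: "u \<in> W" "w \<in> W" for u w
  proof
    assume e: "{u, w} \<in> edges G"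
    have "{u, w} \<in> nonedges K"
      using C uw V(1) e K(1) G(1) unfolding type_C_def nonedges_def simple_graph_def by auto
    then have "{u, w} \<in> good_C K W X v" using uw unfolding good_C_def by auto
    then show False using no e by blast
  qed
  have nb: "w \<in> nbrs_in K W x"
    if xw: "x \<in> ?Y" "w \<in> W" "{x, w} \<in> edges G" "card (nbrs_in K W x) \<le> 1" for x w
  proof (rule ccontr)
    assume "w \<notin> nbrs_in K W x"
    then have "{w, x} \<in> nonedges K"
      using xw V(1) K(1) G(1) unfolding nbrs_in_def nonedges_def simple_graph_def
      by (auto simp: insert_commute)
    then have "{w, x} \<in> good_C K W X v" using xw unfolding good_C_def by blast
    then show False using no xw(3) by (metis insert_commute)
  qed
  have finN: "finite (nbrs_in K W x)" for x using fin unfolding nbrs_in_def by simp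
  define N1 where "N1 = {x \<in> ?Y. card (nbrs_in K W x) = 1}"
  define N2 where "N2 = {x \<in> ?Y. card (nbrs_in K W x) > 1}"
  \<comment> \<open>\<open>A\<close> and \<open>B\<close> are the vertices after and before those of
    \<open>W\<close> on the cycle. Both have |W| elements and avoid \<open>W\<close>, which is
    independent.\<close>
  define A where "A = s ` W"
  define B where "B = {x \<in> ?Y. s x \<in> W}"
  have "s u \<in> ?Y" if "u \<in> W" for u
    using succ_mem[of u] succ_edge[of u] indep[OF that, of "s u"] that by blast
  then have AY: "A \<subseteq> ?Y" and EW: "exits \<inter> W = W" unfolding A_def exits_def by auto
  have pred: "\<exists>w\<in>W. s w = x \<and> {x, w} \<in> edges G" if "x \<in> A" for x
    using that succ_edge unfolding A_def by (auto simp: insert_commute)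
  have succ: "s x \<in> W \<and> {x, s x} \<in> edges G" if "x \<in> B" for x
    using that succ_edge unfolding B_def by auto
  have cA: "card A = card W"
    unfolding A_def by (rule card_image) (rule inj_on_subset[OF inj_succ], blast)
  have cB: "card B = card W"
    using card_entries[of W] EW unfolding B_def closed_in_W_def by auto
  have AB: "A \<union> B \<subseteq> N1 \<union> N2"
  proof
    fix x assume x: "x \<in> A \<union> B"
    then have xY: "x \<in> ?Y" using AY unfolding B_def by auto
    obtain w where "w \<in> W" "{x, w} \<in> edges G" using x pred succ by blast
    then have "w \<in> nbrs_in K W x" if "card (nbrs_in K W x) = 0" using nb[OF xY, of w] that by simp
    then have "card (nbrs_in K W x) \<noteq> 0" using finN[of x] by auto
    then show "x \<in> N1 \<union> N2" using xY unfolding N1_def N2_def by auto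
  qed
  \<comment> \<open>A vertex in both sets is flanked by two vertices of \<open>W\<close>, distinct
    because the cycle is longer than two. By \<open>nb\<close> it cannot have had at most one
    neighbour in \<open>W\<close> already in \<open>K\<close>.\<close>
  have AB2: "A \<inter> B \<subseteq> N2"
  proof (rule subsetI, rule ccontr)
    fix x assume x: "x \<in> A \<inter> B" "x \<notin> N2"
    then have xY: "x \<in> ?Y" and le: "card (nbrs_in K W x) \<le> 1" using AY unfolding N2_def by auto
    obtain p where p: "p \<in> W" "s p = x" "{x, p} \<in> edges G" using x pred by blast
    have "p \<noteq> s x" using succ_succ[of x] p xY by auto
    moreover have "p \<in> nbrs_in K W x" "s x \<in> nbrs_in K W x"
      using nb[OF xY _ _ le] p succ[of x] x by auto
    ultimately have "2 \<le> card (nbrs_in K W x)" using card_two_le finN by metis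
    then show False using le by simp
  qed
  have fins: "finite A" "finite B" "finite N1" "finite N2"
    using fin unfolding A_def B_def N1_def N2_def by auto
  \<comment> \<open>Here |A| + |B| is split so that |A Un B| <= n1 + n2 and |A Int B| <= n2.\<close>
  have "2 * card W = card (A \<union> B) + card (A \<inter> B)" using card_Un_Int[OF fins(1,2)] cA cB by simp
  also have "\<dots> \<le> card (N1 \<union> N2) + card N2" using AB AB2 fins by (intro add_mono card_mono) auto
  also have "\<dots> \<le> card N1 + 2 * card N2" using card_Un_le[of N1 N2] by simp
  finally show False using C unfolding type_C_def N1_def N2_def by simp
qed

text \<open>The last case is excluded since there \<open>K\<close> may already be \<open>G\<close>.
  In the two degree cases \<open>G\<close> has larger degree at \<open>v\<close>: it is at least
  three, and not equal to three where the triangle of \<open>K\<close> survives in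
  \<open>G\<close>.\<close>

lemma candidates_good_edge:
  assumes G: "simple_graph G" "hypohamiltonian G" "card (verts G) \<ge> 2"
    and K: "verts K = verts G" "edges K \<subseteq> edges G"
    and cand: "candidates K E" and "\<not> last_case K"
  shows "\<exists>e\<in>E. e \<in> edges G"
  using cand
proof cases
  case (case_A W X)
  then show ?thesis using type_A_good_edge[OF G(1,2) K] by blast
next
  case (case_C W X v)
  then show ?thesis using type_C_good_edge[OF G(1,2) K] by blast
next
  case (case_B W X)
  then show ?thesis using type_B_good_edge[OF G(1,2) K] by blast
next
  case case_last
  then show ?thesis using assms(7) by blast
next
  case (case_deg2 v)
  then have "degree K v = 2" "v \<in> verts G" using K unfolding deg2_vertex_def by auto
  then have "degree K v < degree G v" using hypohamiltonian_degree_ge_3[OF G] by fastforce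
  then show ?thesis using edge_nonedge_if_degree_less[OF G(1) K] case_deg2 by blast
next
  case (case_deg3_triangle v)
  then obtain u w where v: "v \<in> verts K" "degree K v = 3"
    and tri: "{u, v} \<in> edges G" "{v, w} \<in> edges G" "{u, w} \<in> edges G"
    using K unfolding deg3_triangle_vertex_def by blast
  have "degree G v \<noteq> 3" using hypohamiltonian_degree_3_no_triangle[OF G(1,2) _ tri] by blast
  then have "degree K v < degree G v" using degree_mono[OF G(1) K(2), of v] v by simp
  then show ?thesis using edge_nonedge_if_degree_less[OF G(1) K] case_deg3_triangle by blast
qed


section \<open>Isomorphism\<close>

lemma graph_iso_refl: "graph_iso G G"
  unfolding graph_iso_def by (rule exI[of _ id]) simp

lemma graph_iso_trans:
  assumes "graph_iso G H" "graph_iso H K"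
  shows "graph_iso G K"
proof -
  obtain f where f: "bij_betw f (verts G) (verts H)"
    "\<And>u v. u \<in> verts G \<Longrightarrow> v \<in> verts G \<Longrightarrow> {u, v} \<in> edges G \<longleftrightarrow> {f u, f v} \<in> edges H"
    using assms(1) unfolding graph_iso_def by blast
  obtain g where g: "bij_betw g (verts H) (verts K)"
    "\<And>u v. u \<in> verts H \<Longrightarrow> v \<in> verts H \<Longrightarrow> {u, v} \<in> edges H \<longleftrightarrow> {g u, g v} \<in> edges K"
    using assms(2) unfolding graph_iso_def by blast
  have "{u, v} \<in> edges G \<longleftrightarrow> {(g \<circ> f) u, (g \<circ> f) v} \<in> edges K"
    if "u \<in> verts G" "v \<in> verts G" for u v
    using f(2)[OF that] g(2)[of "f u" "f v"] bij_betwE[OF f(1)] that by simp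
  then show ?thesis using bij_betw_trans[OF f(1) g(1)] unfolding graph_iso_def by blast
qed

lemma graph_iso_sym:
  assumes "graph_iso G H"
  shows "graph_iso H G"
proof -
  obtain f where f: "bij_betw f (verts G) (verts H)"
    "\<And>u v. u \<in> verts G \<Longrightarrow> v \<in> verts G \<Longrightarrow> {u, v} \<in> edges G \<longleftrightarrow> {f u, f v} \<in> edges H"
    using assms unfolding graph_iso_def by blast
  let ?g = "inv_into (verts G) f"
  have g: "?g u \<in> verts G" "f (?g u) = u" if "u \<in> verts H" for u
    using f(1) that bij_betw_imp_surj_on[OF f(1)] by (auto intro: inv_into_into f_inv_into_f)
  have "{u, v} \<in> edges H \<longleftrightarrow> {?g u, ?g v} \<in> edges G" if "u \<in> verts H" "v \<in> verts H" for u v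
    using f(2)[of "?g u" "?g v"] g that by simp
  then show ?thesis using bij_betw_inv_into[OF f(1)] unfolding graph_iso_def by blast
qed

lemma graph_iso_hamiltonian:
  assumes "graph_iso G H" "hamiltonian G"
  shows "hamiltonian H"
proof -
  obtain f where f: "bij_betw f (verts G) (verts H)"
    "\<And>u v. u \<in> verts G \<Longrightarrow> v \<in> verts G \<Longrightarrow> {u, v} \<in> edges G \<longleftrightarrow> {f u, f v} \<in> edges H"
    using assms unfolding graph_iso_def by blast
  obtain vs where vs: "is_cycle G vs" "set vs = verts G" using assms(2) unfolding hamiltonian_def by blast
  have ne: "vs \<noteq> []" using vs unfolding is_cycle_def is_path_def by simp
  have img: "set (map f vs) = verts H" using vs(2) f(1) by (simp add: bij_betw_imp_surj_on)
  have "successively (\<lambda>u v. {f u, f v} \<in> edges H) vs \<longleftrightarrow> successively (\<lambda>u v. {u, v} \<in> edges G) vs"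
    by (rule successively_cong) (use f(2) vs(2) in auto)
  moreover have "{f (last vs), f (hd vs)} \<in> edges H"
    using f(2)[of "last vs" "hd vs"] vs last_in_set[OF ne] hd_in_set[OF ne]
    unfolding is_cycle_def by blast
  ultimately have "is_cycle H (map f vs)"
    using vs ne img bij_betw_imp_inj_on[OF f(1)] unfolding is_cycle_def is_path_def
    by (simp add: distinct_map successively_map last_map hd_map)
  then show ?thesis using img unfolding hamiltonian_def by blast
qed

lemma graph_iso_hypohamiltonian:
  assumes "graph_iso G H" "hypohamiltonian G"
  shows "hypohamiltonian H"
proof -
  obtain f where f: "bij_betw f (verts G) (verts H)"
    "\<And>u v. u \<in> verts G \<Longrightarrow> v \<in> verts G \<Longrightarrow> {u, v} \<in> edges G \<longleftrightarrow> {f u, f v} \<in> edges H"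
    using assms unfolding graph_iso_def by blast
  have "hamiltonian (remove_verts H {w})" if w: "w \<in> verts H" for w
  proof -
    obtain v where v: "v \<in> verts G" "w = f v" using w f(1) by (auto simp: bij_betw_def)
    have inj: "f x = f v \<longleftrightarrow> x = v" if "x \<in> verts G" for x
      using bij_betw_imp_inj_on[OF f(1)] that v(1) by (auto dest: inj_onD)
    have "bij_betw f (verts G - {v}) (verts H - {w})"
      using bij_betw_imp_inj_on[OF f(1)] bij_betw_imp_surj_on[OF f(1)] inj v
      by (auto simp: bij_betw_def inj_on_def image_iff)
    then have "graph_iso (remove_verts G {v}) (remove_verts H {w})"
      using f inj v bij_betwE[OF f(1)] unfolding graph_iso_def remove_verts_def induced_def
      by (intro exI[of _ f]) (simp add: Int_absorb1)
    then show ?thesis using assms(2) v(1) graph_iso_hamiltonian unfolding hypohamiltonian_def by blast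
  qed
  then show ?thesis using assms graph_iso_hamiltonian[OF graph_iso_sym[OF assms(1)]]
    unfolding hypohamiltonian_def by blast
qed

section \<open>Supergraphs and relabelled graphs\<close>

lemma hamiltonian_mono:
  assumes "hamiltonian K" "verts K = verts G" "edges K \<subseteq> edges G"
  shows "hamiltonian G"
proof -
  obtain vs where vs: "is_cycle K vs" "set vs = verts K" using assms(1) unfolding hamiltonian_def by blast
  then have "successively (\<lambda>u v. {u, v} \<in> edges K) vs" unfolding is_cycle_def is_path_def by blast
  then have "successively (\<lambda>u v. {u, v} \<in> edges G) vs"
    by (rule successively_mono) (use assms(3) in blast)
  then have "is_cycle G vs" using vs assms(2,3) unfolding is_cycle_def is_path_def by auto
  then show ?thesis using vs assms(2) unfolding hamiltonian_def by auto
qed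

text \<open>This allows a bijection between two subgraphs to be applied to a larger graph on the
  same vertices, for which \<open>graph_iso\<close> provides no image.\<close>

definition map_graph :: "('a \<Rightarrow> 'b) \<Rightarrow> 'a ugraph \<Rightarrow> 'b ugraph" where
  "map_graph f G = \<lparr>verts = f ` verts G, edges = (`) f ` edges G\<rparr>"

lemma image_edge_iff:
  assumes "inj_on f (verts G)" "simple_graph G" "e \<subseteq> verts G"
  shows "f ` e \<in> (`) f ` edges G \<longleftrightarrow> e \<in> edges G"
proof -
  have "f ` e = f ` d \<Longrightarrow> e = d" if "d \<in> edges G" for d
    using inj_on_image_eq_iff[OF assms(1,3), of d] that assms(2) unfolding simple_graph_def by blast
  then show ?thesis by blast
qed

lemma simple_graph_map_graph:
  assumes "inj_on f (verts G)" "simple_graph G"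
  shows "simple_graph (map_graph f G)"
proof -
  have "card (f ` e) = 2" if "e \<in> edges G" for e
    using that assms card_image[OF inj_on_subset[OF assms(1)], of e] unfolding simple_graph_def by auto
  then show ?thesis using assms(2) unfolding simple_graph_def map_graph_def by auto
qed

lemma graph_iso_map_graph:
  assumes "inj_on f (verts G)" "simple_graph G"
  shows "graph_iso G (map_graph f G)"
proof -
  have "{u, v} \<in> edges G \<longleftrightarrow> {f u, f v} \<in> edges (map_graph f G)"
    if "u \<in> verts G" "v \<in> verts G" for u v
    using image_edge_iff[OF assms, of "{u, v}"] that unfolding map_graph_def by simp
  then show ?thesis unfolding graph_iso_def
    by (intro exI[of _ f]) (simp add: bij_betw_def assms(1) map_graph_def)
qed

text \<open>\<open>graph_iso\<close> compares pairs of vertices only; in simple graphs every edge is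
  such a pair, so the target is literally the image.\<close>

lemma graph_isoE:
  assumes "graph_iso G H" "simple_graph G" "simple_graph H"
  obtains f where "inj_on f (verts G)" "H = map_graph f G"
proof -
  obtain f where f: "bij_betw f (verts G) (verts H)"
    "\<And>u v. u \<in> verts G \<Longrightarrow> v \<in> verts G \<Longrightarrow> {u, v} \<in> edges G \<longleftrightarrow> {f u, f v} \<in> edges H"
    using assms unfolding graph_iso_def by blast
  have img: "f ` verts G = verts H" using f(1) by (rule bij_betw_imp_surj_on)
  have "edges H = (`) f ` edges G"
  proof (intro equalityI subsetI)
    fix e assume e: "e \<in> edges H"
    then have "card e = 2" "e \<subseteq> verts H" using assms(3) unfolding simple_graph_def by auto
    then obtain a b where "e = {a, b}" "a \<in> verts H" "b \<in> verts H" by (auto simp: card_2_iff)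
    then obtain u v where "e = {f u, f v}" "u \<in> verts G" "v \<in> verts G"
      unfolding img[symmetric] by blast
    then have "{u, v} \<in> edges G" "e = f ` {u, v}" using f(2) e by auto
    then show "e \<in> (`) f ` edges G" by blast
  next
    fix e assume "e \<in> (`) f ` edges G"
    then obtain d where d: "e = f ` d" "d \<in> edges G" by blast
    then have "card d = 2" "d \<subseteq> verts G" using assms(2) unfolding simple_graph_def by auto
    then obtain a b where "d = {a, b}" "a \<in> verts G" "b \<in> verts G" by (auto simp: card_2_iff)
    then show "e \<in> edges H" using d f(2) by auto
  qed
  then have "H = map_graph f G" using img by (simp add: map_graph_def)
  then show thesis using that bij_betw_imp_inj_on[OF f(1)] by blast
qed

lemma max_degree_map_graph:
  assumes inj: "inj_on f (verts G)" and G: "simple_graph G"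
  shows "max_degree (map_graph f G) = max_degree G"
proof -
  have "degree (map_graph f G) (f v) = degree G v" if v: "v \<in> verts G" for v
  proof -
    have sub: "e \<subseteq> verts G" if "e \<in> edges G" for e using G that unfolding simple_graph_def by blast
    have "f v \<in> f ` e \<longleftrightarrow> v \<in> e" if "e \<in> edges G" for e
      using inj_on_image_mem_iff[OF inj v sub[OF that]] .
    then have "{e \<in> edges (map_graph f G). f v \<in> e} = (`) f ` {e \<in> edges G. v \<in> e}"
      unfolding map_graph_def by auto
    moreover have "inj_on ((`) f) {e \<in> edges G. v \<in> e}"
      using inj_on_image_eq_iff[OF inj] sub by (auto simp: inj_on_def)
    ultimately show ?thesis unfolding degree_def by (simp add: card_image)
  qed
  then have "degree (map_graph f G) ` verts (map_graph f G) = degree G ` verts G"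
    by (auto simp: map_graph_def image_image)
  then show ?thesis unfolding max_degree_def by simp
qed

lemma max_degree_mono:
  assumes G: "simple_graph G" and K: "verts K = verts G" "edges K \<subseteq> edges G"
  shows "max_degree K \<le> max_degree G"
\<comment> \<open>Without vertices both sides are the same unspecified
  \<open>Max {}\<close>.\<close>
proof (cases "verts G = {}")
  case False
  have fin: "finite (verts G)" using G unfolding simple_graph_def by simp
  have "degree K v \<le> Max (degree G ` verts G)" if "v \<in> verts G" for v
    by (rule order_trans[OF degree_mono[OF G K(2)] Max_ge]) (use fin that in auto)
  then show ?thesis using False fin K(1) unfolding max_degree_def by simp
qed (simp add: max_degree_def K)


section \<open>Invariants of the search\<close>

text \<open>All calls that \<open>K\<close> has to make, for one admissible choice, have been made.
  \<open>D\<close> is replaced by \<open>max_degree K\<close>, which equals it in every call of the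
  run and is invariant under isomorphism, so skipping cannot mix up different
  \<open>D\<close>.\<close>

definition resolved :: "'a state \<Rightarrow> 'a ugraph \<Rightarrow> bool" where
  "resolved s K \<longleftrightarrow> \<not> hamiltonian K \<and> (last_case K \<and> hypohamiltonian K \<longrightarrow> K \<in> set (snd s)) \<and>
     (\<exists>E. candidates K E \<and>
       (\<forall>e\<in>E. max_degree (add_edge K e) = max_degree K \<longrightarrow> add_edge K e \<in> fst s))"

text \<open>\<open>P\<close> holds the graphs whose calls are still in progress.\<close>

definition covered :: "'a ugraph set \<Rightarrow> 'a state \<Rightarrow> bool" where
  "covered P s \<longleftrightarrow> (\<forall>K\<in>fst s. hamiltonian K \<or>
     (\<exists>K'\<in>fst s. graph_iso K K' \<and> (K' \<in> P \<or> resolved s K')))"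

text \<open>\<open>graph_iso H' H\<close> has the orientation of the test in
  \<open>construct\<close>, new graph against earlier one. That test covers earlier outputs because
  they lie in \<open>fst s\<close>.\<close>

definition sound_state :: "'a set \<Rightarrow> 'a state \<Rightarrow> bool" where
  "sound_state V s \<longleftrightarrow> (\<forall>K\<in>fst s. simple_graph K \<and> verts K = V) \<and> set (snd s) \<subseteq> fst s \<and>
     (\<forall>H\<in>set (snd s). hypohamiltonian H) \<and> sorted_wrt (\<lambda>H H'. \<not> graph_iso H' H) (snd s)"

definition extends :: "'a state \<Rightarrow> 'a state \<Rightarrow> bool" where
  "extends s s' \<longleftrightarrow> fst s \<subseteq> fst s' \<and> set (snd s) \<subseteq> set (snd s')"

lemma extends_trans: "extends s t \<Longrightarrow> extends t u \<Longrightarrow> extends s u"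
  unfolding extends_def by blast

lemma resolved_mono: "resolved s K \<Longrightarrow> extends s t \<Longrightarrow> resolved t K"
  unfolding resolved_def extends_def by blast

text \<open>The earlier graph \<open>G'\<close> may have been skipped itself. Whatever covers it
  covers \<open>G\<close> by transitivity, and if it is hamiltonian, so is \<open>G\<close>.\<close>

lemma covered_skip:
  assumes "covered P (gen, Hs)" "hamiltonian G \<or> (\<exists>G'\<in>gen. graph_iso G G')"
  shows "covered P (insert G gen, Hs)"
proof -
  have ext: "extends (gen, Hs) (insert G gen, Hs)" unfolding extends_def by auto
  have old: "hamiltonian K \<or> (\<exists>K'\<in>insert G gen. graph_iso K K' \<and>
      (K' \<in> P \<or> resolved (insert G gen, Hs) K'))" if "K \<in> gen" for K
    using assms(1) that resolved_mono[OF _ ext] unfolding covered_def by fastforce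
  have "hamiltonian G \<or> (\<exists>K'\<in>insert G gen. graph_iso G K' \<and>
      (K' \<in> P \<or> resolved (insert G gen, Hs) K'))"
    using assms(2)
  proof
    assume "\<exists>G'\<in>gen. graph_iso G G'"
    then obtain G' where G': "G' \<in> gen" "graph_iso G G'" by blast
    from old[OF G'(1)] show ?thesis
      using graph_iso_hamiltonian[OF graph_iso_sym[OF G'(2)]] graph_iso_trans[OF G'(2)] by blast
  qed blast
  then show ?thesis using old unfolding covered_def by auto
qed

lemma covered_enter:
  assumes "covered P (gen, Hs)" "set Hs \<subseteq> set Hs'"
  shows "covered (insert G P) (insert G gen, Hs')"
proof -
  have ext: "extends (gen, Hs) (insert G gen, Hs')" using assms(2) unfolding extends_def by auto
  have "hamiltonian K \<or> (\<exists>K'\<in>insert G gen. graph_iso K K' \<and>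
      (K' \<in> insert G P \<or> resolved (insert G gen, Hs') K'))" if "K \<in> gen" for K
    using assms(1) that resolved_mono[OF _ ext] unfolding covered_def by fastforce
  then show ?thesis using graph_iso_refl[of G] unfolding covered_def by auto
qed

lemma covered_leave: "covered (insert G P) s \<Longrightarrow> resolved s G \<Longrightarrow> covered P s"
  unfolding covered_def by blast

text \<open>The calls made for \<open>G\<close> run with \<open>G\<close> in progress, so a claim
  about \<open>P\<close> uses the induction hypothesis for \<open>insert G P\<close>; hence the
  inner quantifier. Once they have ended, \<open>G\<close> is resolved and leaves
  \<open>P\<close>.\<close>

lemma construct_invariant:
  fixes V :: "'a set"
  shows "construct G D s s' \<Longrightarrow> max_degree G = D \<and> simple_graph G \<and> verts G = V \<and> sound_state V s \<Longrightarrow>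
      G \<in> fst s' \<and> extends s s' \<and> sound_state V s' \<and> (\<forall>P. covered P s \<longrightarrow> covered P s')"
    and "construct_all cs s s' \<Longrightarrow>
      (\<forall>(G, D)\<in>set cs. max_degree G = D \<and> simple_graph G \<and> verts G = V) \<and> sound_state V s \<Longrightarrow>
      fst ` set cs \<subseteq> fst s' \<and> extends s s' \<and> sound_state V s' \<and> (\<forall>P. covered P s \<longrightarrow> covered P s')"
proof (induction rule: construct_construct_all.inducts)
  case (construct_skip G gen D Hs)
  then show ?case using covered_skip[of _ gen Hs G] by (auto simp: sound_state_def extends_def)
next
  case (construct_branch G gen E es D Hs' Hs s')
  let ?s = "(insert G gen, Hs')"
  have E: "e \<in> nonedges G" if "e \<in> E" for e using candidates_nonedges construct_branch(3) that by blast
  have calls: "\<forall>(K, D')\<in>set (map (\<lambda>e. (add_edge G e, D)) es).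
      max_degree K = D' \<and> simple_graph K \<and> verts K = V"
    using construct_branch.prems construct_branch(5) simple_graph_add_edge E by (auto simp: add_edge_def)
  have Hs': "Hs' = (if last_case G \<and> hypohamiltonian G then Hs @ [G] else Hs)" by fact
  have sound: "sound_state V (gen, Hs)" using construct_branch.prems by blast
  have "\<not> graph_iso G H" if "H \<in> set Hs" for H
    using construct_branch(2) sound that unfolding sound_state_def by auto
  then have "sound_state V ?s"
    using sound construct_branch.prems unfolding sound_state_def Hs' by (auto simp: sorted_wrt_append)
  with calls have IH: "fst ` set (map (\<lambda>e. (add_edge G e, D)) es) \<subseteq> fst s'" "extends ?s s'"
      "sound_state V s'" "\<And>P. covered P ?s \<Longrightarrow> covered P s'"
    using construct_branch.IH by blast+
  have ext: "extends (gen, Hs) ?s" unfolding extends_def Hs' by auto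
  \<comment> \<open>Skipped calls are recorded in \<open>fst s'\<close> too, so it does not matter
    which of these calls were expanded.\<close>
  have "add_edge G e \<in> fst s'" if "e \<in> E" "max_degree (add_edge G e) = max_degree G" for e
    using IH(1) that construct_branch(5) construct_branch.prems by fastforce
  moreover have "G \<in> set (snd s')" if "last_case G \<and> hypohamiltonian G"
    using IH(2) that unfolding extends_def Hs' by auto
  ultimately have "resolved s' G" using construct_branch(1,3) unfolding resolved_def by blast
  moreover have "set Hs \<subseteq> set Hs'" unfolding Hs' by auto
  ultimately have "covered P s'" if "covered P (gen, Hs)" for P
    using covered_leave IH(4)[OF covered_enter[OF that, of Hs' G]] by blast
  then show ?case using IH extends_trans[OF ext IH(2)] unfolding extends_def by auto
next
  case (construct_all_Nil s)
  then show ?case by (simp add: extends_def)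
next
  case (construct_all_Cons G D s s' cs s'')
  have 1: "G \<in> fst s' \<and> extends s s' \<and> sound_state V s' \<and> (\<forall>P. covered P s \<longrightarrow> covered P s')"
    using construct_all_Cons.prems by (intro construct_all_Cons.IH(1)) auto
  then have 2: "fst ` set cs \<subseteq> fst s'' \<and> extends s' s'' \<and> sound_state V s'' \<and>
      (\<forall>P. covered P s' \<longrightarrow> covered P s'')"
    using construct_all_Cons.prems by (intro construct_all_Cons.IH(2)) auto
  then show ?case using 1 extends_trans[of s s' s''] by (auto simp: extends_def)
qed


section \<open>The start graphs\<close>

lemma simple_graph_connect_h:
  assumes "n \<ge> 4" "S \<subseteq> {..<n - 1}"
  shows "simple_graph (connect_h n S)"
proof -
  have "(i + 1) mod (n - 1) \<noteq> i" "(i + 1) mod (n - 1) < n" if "i < n - 1" for i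
    using that assms(1) by (cases "i + 1 = n - 1"; simp)+
  then show ?thesis using assms(2)
    unfolding simple_graph_def connect_h_def cycle_and_isolated_def by (fastforce simp: card_2_iff)
qed

text \<open>A cycle vertex has two cycle edges and perhaps the edge to \<open>h\<close>, so
  \<open>card S \<ge> 3\<close> makes \<open>h\<close> a vertex of maximum degree.\<close>

lemma max_degree_connect_h:
  assumes n: "n \<ge> 4" and S: "S \<subseteq> {..<n - 1}" "card S \<ge> 3"
  shows "max_degree (connect_h n S) = card S"
proof -
  let ?G = "connect_h n S" and ?m = "n - 1"
  have lt: "(i + 1) mod ?m < ?m" for i using n by (intro mod_less_divisor) simp
  have "{e \<in> edges ?G. ?m \<in> e} = (\<lambda>v. {?m, v}) ` S"
  proof -
    have "?m \<notin> {i, (i + 1) mod ?m}" if "i < ?m" for i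
      using lt[of i] that by (metis insert_iff empty_iff less_irrefl)
    then show ?thesis unfolding connect_h_def cycle_and_isolated_def by auto
  qed
  moreover have "inj_on (\<lambda>v. {?m, v}) S" by (auto simp: inj_on_def doubleton_eq_iff)
  ultimately have h: "degree ?G ?m = card S" unfolding degree_def by (simp add: card_image)
  have le: "degree ?G v \<le> card S" if v: "v < n" for v
  proof (cases "v = ?m")
    case False
    then have vm: "v < ?m" using v by simp
    \<comment> \<open>Adding \<open>?m - 1\<close> modulo \<open>?m\<close> steps back on the cycle,
      also from vertex 0.\<close>
    have pred: "i = (v + (?m - 1)) mod ?m" if i: "i < ?m" "v = (i + 1) mod ?m" for i
    proof -
      have "(v + (?m - 1)) mod ?m = (i + 1 + (?m - 1)) mod ?m" unfolding i(2) by (rule mod_add_left_eq)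
      also have "i + 1 + (?m - 1) = i + ?m" using n by simp
      also have "(i + ?m) mod ?m = i" using i(1) by (metis mod_add_self2 mod_less)
      finally show ?thesis by simp
    qed
    let ?T = "{{v, (v + 1) mod ?m}, {(v + (?m - 1)) mod ?m, v}, {?m, v}}"
    have "{e \<in> edges ?G. v \<in> e} \<subseteq> ?T"
    proof
      fix e assume "e \<in> {e \<in> edges ?G. v \<in> e}"
      then have ve: "v \<in> e" and "(\<exists>i<?m. e = {i, (i + 1) mod ?m}) \<or> (\<exists>w. e = {?m, w})"
        unfolding connect_h_def cycle_and_isolated_def by auto
      then consider i where "i < ?m" "e = {i, (i + 1) mod ?m}" | w where "e = {?m, w}" by blast
      then show "e \<in> ?T"
      proof cases
        case 1
        have "v = i \<or> v = (i + 1) mod ?m" using ve 1(2) by blast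
        then have "e = {v, (v + 1) mod ?m} \<or> e = {(v + (?m - 1)) mod ?m, v}"
          using pred[OF 1(1)] 1(2) by metis
        then show ?thesis by blast
      next
        case 2
        then show ?thesis using ve False by blast
      qed
    qed
    then have "degree ?G v \<le> card ?T" unfolding degree_def by (intro card_mono) auto
    also have "\<dots> \<le> 3"
      using card_length[of "[{v, (v + 1) mod ?m}, {(v + (?m - 1)) mod ?m, v}, {?m, v}]"] by simp
    finally show ?thesis using S(2) by simp
  qed (use h in simp)
  have V: "verts ?G = {..<n}" unfolding connect_h_def cycle_and_isolated_def by simp
  show ?thesis unfolding max_degree_def V
  proof (rule Max_eqI)
    show "card S \<in> degree ?G ` {..<n}" using h n by (intro image_eqI[of _ _ ?m]) auto
  qed (use le in auto)
qed

lemma is_cycle_nth_edge: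
  assumes "is_cycle G vs" "i < length vs"
  shows "{vs ! i, vs ! (Suc i mod length vs)} \<in> edges G"
proof (cases "Suc i < length vs")
  case True
  then show ?thesis using assms unfolding is_cycle_def is_path_def by (auto simp: successively_conv_nth)
next
  case False
  then have "Suc i = length vs" "vs \<noteq> []" using assms(2) by auto
  then show ?thesis using assms unfolding is_cycle_def by (simp add: last_conv_nth hd_conv_nth flip: \<open>Suc i = length vs\<close>)
qed

text \<open>Number the vertices along a hamiltonian cycle of \<open>G - h\<close> by 0, ..., n - 2
  and give \<open>h\<close> the number n - 1. \<open>S\<close> is then the neighbourhood of
  \<open>h\<close>, of size at least three by the minimum degree.\<close>

lemma hypohamiltonian_contains_start:
  fixes G :: "'a ugraph"
  assumes G: "simple_graph G" "hypohamiltonian G" and n: "card (verts G) = n" "n \<ge> 4"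
  obtains S G' where "graph_iso G G'" "simple_graph G'" "verts G' = {..<n}"
    "edges (connect_h n S) \<subseteq> edges G'" "S \<subseteq> {..<n - 1}" "card S = max_degree G'" "card S \<ge> 3"
proof -
  have finV: "finite (verts G)" "verts G \<noteq> {}" using n by (auto intro: card_ge_0_finite)
  then have "max_degree G \<in> degree G ` verts G" unfolding max_degree_def by (intro Max_in) auto
  then obtain h where h: "h \<in> verts G" "degree G h = max_degree G" by auto
  obtain vs where vs: "is_cycle (remove_verts G {h}) vs" "set vs = verts (remove_verts G {h})"
    using G(2) h(1) unfolding hypohamiltonian_def hamiltonian_def by blast
  have set: "set vs = verts G - {h}" using vs(2) by (auto simp: remove_verts_def induced_def)
  have d: "distinct vs" using vs(1) unfolding is_cycle_def is_path_def by simp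
  have len: "length vs = n - 1"
    using distinct_card[OF d] set h(1) n(1) finV by simp
  define g where "g i = (if i = n - 1 then h else vs ! i)" for i
  have vsV: "vs ! i \<in> verts G - {h}" if "i < n - 1" for i using that len set nth_mem by metis
  have injg: "inj_on g {..<n}"
  proof (rule inj_onI)
    fix i j assume ij: "i \<in> {..<n}" "j \<in> {..<n}" "g i = g j"
    have lt: "i = n - 1 \<or> i < n - 1" "j = n - 1 \<or> j < n - 1" using ij by auto
    show "i = j"
    proof (cases "i = n - 1 \<or> j = n - 1")
      case True
      then show ?thesis using ij(3) lt vsV[of i] vsV[of j] unfolding g_def by (auto split: if_splits)
    next
      case False
      then show ?thesis using ij(3) lt nth_eq_iff_index_eq[OF d, of i j] len unfolding g_def by auto
    qed
  qed
  have "g ` {..<n} = verts G"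
  proof
    show "g ` {..<n} \<subseteq> verts G" using h(1) vsV unfolding g_def by auto
    show "verts G \<subseteq> g ` {..<n}"
    proof
      fix v assume v: "v \<in> verts G"
      show "v \<in> g ` {..<n}"
      proof (cases "v = h")
        case True
        then show ?thesis using n(2) by (intro image_eqI[of _ _ "n - 1"]) (auto simp: g_def)
      next
        case False
        then have "v \<in> set vs" using v set by blast
        then obtain i where "i < n - 1" "v = vs ! i" using len by (metis in_set_conv_nth)
        then show ?thesis by (intro image_eqI[of _ _ i]) (auto simp: g_def)
      qed
    qed
  qed
  then have bijg: "bij_betw g {..<n} (verts G)" using injg by (simp add: bij_betw_def)
  define f where "f = the_inv_into {..<n} g"
  have bijf: "bij_betw f (verts G) {..<n}" unfolding f_def by (rule bij_betw_the_inv_into[OF bijg])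
  have fg: "f (g i) = i" if "i < n" for i unfolding f_def using that by (simp add: the_inv_into_f_f[OF injg])
  have fvs: "f (vs ! i) = i" if "i < n - 1" for i using fg[of i] that unfolding g_def by auto
  have fh: "f h = n - 1" using fg[of "n - 1"] n(2) unfolding g_def by simp
  have injf: "inj_on f (verts G)" using bijf by (rule bij_betw_imp_inj_on)
  define S where "S = {i. i < n - 1 \<and> {h, vs ! i} \<in> edges G}"
  let ?G = "map_graph f G"
  have memE: "f ` e \<in> edges ?G" if "e \<in> edges G" for e using that by (simp add: map_graph_def)
  have "edges (connect_h n S) \<subseteq> edges ?G"
  proof
    fix e assume "e \<in> edges (connect_h n S)"
    then consider i where "i < n - 1" "e = {i, (i + 1) mod (n - 1)}"
      | i where "e = {n - 1, i}" "i \<in> S"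
      unfolding connect_h_def cycle_and_isolated_def by auto
    then show "e \<in> edges ?G"
    proof cases
      case 1
      have "{vs ! i, vs ! (Suc i mod (n - 1))} \<in> edges G"
        using is_cycle_nth_edge[OF vs(1), of i] 1(1) len by (auto simp: remove_verts_def induced_def)
      moreover have "Suc i mod (n - 1) < n - 1" using n(2) by (intro mod_less_divisor) simp
      ultimately show ?thesis using memE fvs 1 by fastforce
    next
      case 2
      then have "f ` {h, vs ! i} = e" "{h, vs ! i} \<in> edges G" using fvs fh unfolding S_def by auto
      then show ?thesis using memE by metis
    qed
  qed
  moreover have "card S = degree G h"
    unfolding degree_def
  proof (rule bij_betw_same_card)
    show "bij_betw (\<lambda>i. {h, vs ! i}) S {e \<in> edges G. h \<in> e}"
      unfolding bij_betw_def
    proof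
      show "inj_on (\<lambda>i. {h, vs ! i}) S"
        unfolding S_def using fvs by (auto simp: inj_on_def doubleton_eq_iff) metis+
      have "e \<in> (\<lambda>i. {h, vs ! i}) ` S" if e: "e \<in> edges G" "h \<in> e" for e
      proof -
        obtain w where w: "e = {h, w}" "h \<noteq> w" using simple_graph_edgeE[OF G(1) e] by blast
        then have "{h, w} \<in> edges G" using e(1) by simp
        then have "w \<in> set vs" using set simple_graph_edge(2)[OF G(1)] w(2) by auto
        then obtain i where "i < n - 1" "w = vs ! i" using len by (metis in_set_conv_nth)
        then show ?thesis using w e unfolding S_def by auto
      qed
      then show "(\<lambda>i. {h, vs ! i}) ` S = {e \<in> edges G. h \<in> e}" unfolding S_def by auto
    qed
  qed
  ultimately show thesis
    using that[of ?G S] graph_iso_map_graph[OF injf G(1)] simple_graph_map_graph[OF injf G(1)]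
      max_degree_map_graph[OF injf G(1)] bij_betw_imp_surj_on[OF bijf] h
      hypohamiltonian_degree_ge_3[OF G _ h(1)] n
    by (auto simp: map_graph_def S_def)
qed

text \<open>Among the generated graphs that embed into \<open>G\<close> with the same maximum degree, one with the
  most edges is \<open>G\<close> itself, as \<open>candidates\<close> would provide a further edge of \<open>G\<close> otherwise.\<close>

lemma covered_complete:
  assumes s: "covered {} s" "sound_state V s" and V: "card V \<ge> 2"
    and K0: "K0 \<in> fst s" "edges K0 \<subseteq> edges G" "max_degree K0 = max_degree G"
    and G: "simple_graph G" "verts G = V" "hypohamiltonian G"
  shows "\<exists>H\<in>set (snd s). graph_iso G H"
proof -
  have gen: "simple_graph K \<and> verts K = V" if "K \<in> fst s" for K
    using s(2) that unfolding sound_state_def by blast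
  \<comment> \<open>Passing to an isomorphic generated graph changes labels, so \<open>Q\<close>
    lets \<open>G\<close> vary over its copies on \<open>V\<close>.\<close>
  define Q where "Q K \<longleftrightarrow> K \<in> fst s \<and> max_degree K = max_degree G \<and>
    (\<exists>G'. graph_iso G G' \<and> simple_graph G' \<and> verts G' = V \<and> max_degree G' = max_degree G \<and>
      edges K \<subseteq> edges G')" for K
  have "Q K0" unfolding Q_def using K0 G graph_iso_refl by blast
  moreover have "card (edges K) \<le> card (Pow V)" if "Q K" for K
  proof (rule card_mono)
    have "simple_graph K" "verts K = V" using gen that unfolding Q_def by auto
    then show "finite (Pow V)" "edges K \<subseteq> Pow V" unfolding simple_graph_def by auto
  qed
  then have "\<forall>K. Q K \<longrightarrow> card (edges K) < Suc (card (Pow V))" by (simp add: less_Suc_eq_le)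
  ultimately obtain K where K: "Q K" "\<And>L. Q L \<Longrightarrow> card (edges L) \<le> card (edges K)"
    using ex_has_greatest_nat[of Q K0 "\<lambda>K. card (edges K)" "Suc (card (Pow V))"] by blast
  obtain G1 where G1: "graph_iso G G1" "simple_graph G1" "verts G1 = V"
      "max_degree G1 = max_degree G" "edges K \<subseteq> edges G1"
    using K(1) unfolding Q_def by blast
  have Ks: "K \<in> fst s" "simple_graph K" "verts K = V" "max_degree K = max_degree G"
    using K(1) gen unfolding Q_def by auto
  \<comment> \<open>\<open>covered\<close> promises nothing for hamiltonian graphs.\<close>
  have "\<not> hamiltonian K"
  proof
    assume "hamiltonian K"
    then have "hamiltonian G1" using hamiltonian_mono G1(3,5) Ks(3) by metis
    then show False using graph_iso_hypohamiltonian[OF G1(1) G(3)] unfolding hypohamiltonian_def by blast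
  qed
  then obtain K' where K': "K' \<in> fst s" "graph_iso K K'" "resolved s K'"
    using s(1) Ks(1) unfolding covered_def by blast
  have K's: "simple_graph K'" "verts K' = V" using gen K'(1) by auto
  obtain f where f: "inj_on f (verts K)" "K' = map_graph f K"
    using graph_isoE[OF K'(2) Ks(2) K's(1)] .
  \<comment> \<open>The isomorphism from \<open>K\<close> to \<open>K'\<close> is applied to the
    whole of \<open>G1\<close>, which yields a copy of \<open>G\<close> containing
    \<open>K'\<close>.\<close>
  define G2 where "G2 = map_graph f G1"
  have injG1: "inj_on f (verts G1)" using f(1) G1(3) Ks(3) by simp
  have isoG2: "graph_iso G G2"
    unfolding G2_def by (rule graph_iso_trans[OF G1(1) graph_iso_map_graph[OF injG1 G1(2)]])
  have G2: "simple_graph G2" "verts G2 = V" "max_degree G2 = max_degree G"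
      "edges K' \<subseteq> edges G2" "hypohamiltonian G2"
    using simple_graph_map_graph[OF injG1 G1(2)] max_degree_map_graph[OF injG1 G1(2)]
      G1 f(2) Ks(3) K's(2) graph_iso_hypohamiltonian[OF isoG2 G(3)]
    unfolding G2_def by (auto simp: map_graph_def)
  have degK': "max_degree K' = max_degree G"
    using max_degree_map_graph[OF f(1) Ks(2)] f(2) Ks(4) by simp
  have "inj_on ((`) f) (edges K)"
    using inj_on_image_eq_iff[OF f(1)] Ks(2) unfolding inj_on_def simple_graph_def by blast
  then have cardK': "card (edges K') = card (edges K)" using f(2) by (simp add: map_graph_def card_image)
  obtain E where E: "candidates K' E"
      "\<And>e. e \<in> E \<Longrightarrow> max_degree (add_edge K' e) = max_degree K' \<Longrightarrow> add_edge K' e \<in> fst s"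
    using K'(3) unfolding resolved_def by blast
  \<comment> \<open>The maximum degree of \<open>?L\<close> lies between the equal ones of
    \<open>K'\<close> and \<open>G2\<close>, so the degree test succeeds and \<open>?L\<close> was
    generated. It has one edge more than \<open>K\<close>, against maximality.\<close>
  have no: "e \<notin> edges G2" if e: "e \<in> E" for e
  proof
    assume eG: "e \<in> edges G2"
    let ?L = "add_edge K' e"
    have e_new: "e \<notin> edges K'" using candidates_nonedges[OF E(1)] e unfolding nonedges_def by blast
    have L: "verts ?L = V" "edges K' \<subseteq> edges ?L" "edges ?L \<subseteq> edges G2"
      using K's(2) G2(4) eG unfolding add_edge_def by auto
    have "simple_graph ?L" using simple_graph_add_edge[OF K's(1)] candidates_nonedges[OF E(1)] e by blast
    then have "max_degree K' \<le> max_degree ?L" using max_degree_mono[of ?L K'] L K's(2) by simp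
    moreover have "max_degree ?L \<le> max_degree G2" using max_degree_mono[of G2 ?L] L G2 by simp
    ultimately have "max_degree ?L = max_degree K'" using degK' G2(3) by simp
    then have "Q ?L" unfolding Q_def using E(2)[OF e] degK' isoG2 G2 L by auto
    moreover have "card (edges ?L) = Suc (card (edges K'))"
      unfolding add_edge_def using e_new simple_graph_finite_edges[OF K's(1)] by simp
    ultimately show False using K(2)[of ?L] cardK' by simp
  qed
  then have last: "last_case K'"
    using candidates_good_edge[OF G2(1,5) _ _ G2(4) E(1)] G2(2) K's(2) V by auto
  \<comment> \<open>Since all non-edges are candidates now, \<open>no\<close> leaves no edge of
    \<open>G2\<close> outside \<open>K'\<close>.\<close>
  have "E = nonedges K'" using E(1) last by cases (auto simp: last_case_def has_A_def has_deg2_def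
      has_C_def has_deg3_triangle_def has_B_def)
  have "edges G2 \<subseteq> edges K'"
  proof
    fix e assume e: "e \<in> edges G2"
    then have "e \<subseteq> verts K'" "card e = 2" using G2(1,2) K's(2) unfolding simple_graph_def by auto
    moreover have "e \<notin> nonedges K'" using no e \<open>E = nonedges K'\<close> by blast
    ultimately show "e \<in> edges K'" unfolding nonedges_def by simp
  qed
  then have "K' = G2" using G2(2,4) K's(2) by (intro ugraph.equality) auto
  then show ?thesis using last K'(3) G2(5) isoG2 unfolding resolved_def by auto
qed

theorem theorem2p8:
  fixes n :: nat and Hs :: "nat ugraph list"
  assumes "n \<ge> 4"
    and "generate n Hs"
  shows "(\<forall>H\<in>set Hs. simple_graph H \<and> card (verts H) = n \<and> hypohamiltonian H) \<and>
    (\<forall>G :: 'a ugraph. simple_graph G \<and> card (verts G) = n \<and> hypohamiltonian G \<longrightarrow>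
      (\<exists>!i. i < length Hs \<and> graph_iso G (Hs ! i)))"
proof -
  obtain starts gen where st: "set starts = {(D, S). 3 \<le> D \<and> D \<le> n - 1 \<and> S \<subseteq> {..<n - 1} \<and> card S = D}"
    and run: "construct_all (map (\<lambda>(D, S). (connect_h n S, D)) starts) ({}, []) (gen, Hs)"
    using assms(2) unfolding generate_def by blast
  have "sound_state {..<n} ({}, [])" unfolding sound_state_def by simp
  moreover have "\<forall>(G, D)\<in>set (map (\<lambda>(D, S). (connect_h n S, D)) starts).
      max_degree G = D \<and> simple_graph G \<and> verts G = {..<n}"
    using max_degree_connect_h[OF assms(1)] simple_graph_connect_h[OF assms(1)]
    by (auto simp: st connect_h_def cycle_and_isolated_def)
  ultimately have inv: "fst ` set (map (\<lambda>(D, S). (connect_h n S, D)) starts) \<subseteq> fst (gen, Hs)"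
      "sound_state {..<n} (gen, Hs)" "\<forall>P. covered P ({}, []) \<longrightarrow> covered P (gen, Hs)"
    using construct_invariant(2)[OF run, of "{..<n}"] by blast+
  have "covered {} ({}, [])" by (simp add: covered_def)
  then have cov: "covered {} (gen, Hs)" using inv(3) by blast
  have hyp: "simple_graph H \<and> card (verts H) = n \<and> hypohamiltonian H" if "H \<in> set Hs" for H
    using inv(2) that unfolding sound_state_def by auto
  have "\<exists>!i. i < length Hs \<and> graph_iso G (Hs ! i)"
    if G: "simple_graph G" "card (verts G) = n" "hypohamiltonian G" for G :: "'a ugraph"
  proof -
    obtain S G' where G': "graph_iso G G'" "simple_graph G'" "verts G' = {..<n}"
      "edges (connect_h n S) \<subseteq> edges G'" "S \<subseteq> {..<n - 1}" "card S = max_degree G'" "card S \<ge> 3"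
      using hypohamiltonian_contains_start[OF G(1,3,2) assms(1)] .
    have "card S \<le> n - 1" using card_mono[OF _ G'(5)] by simp
    then have "(card S, S) \<in> set starts" using st G'(5,7) by simp
    then have "connect_h n S \<in> gen" using inv(1) by force
    moreover have "max_degree (connect_h n S) = max_degree G'"
      using max_degree_connect_h[OF assms(1) G'(5,7)] G'(6) by simp
    ultimately obtain H where "H \<in> set Hs" "graph_iso G' H"
      using covered_complete[OF cov inv(2), of "connect_h n S" G'] G'(2-4)
        graph_iso_hypohamiltonian[OF G'(1) G(3)] assms(1) by auto
    then obtain i where i: "i < length Hs" "graph_iso G (Hs ! i)"
      using graph_iso_trans[OF G'(1)] by (metis in_set_conv_nth)
    \<comment> \<open>Two positions with graphs isomorphic to \<open>G\<close> would hold graphs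
      isomorphic to each other, and the order recorded in \<open>sound_state\<close> excludes
      that.\<close>
    have distinct: "\<not> graph_iso (Hs ! k) (Hs ! j)" if "j < k" "k < length Hs" for j k
      using inv(2) that unfolding sound_state_def by (auto simp: sorted_wrt_iff_nth_less)
    have "j = i" if j: "j < length Hs" "graph_iso G (Hs ! j)" for j
      using distinct[of i j] distinct[of j i] i j graph_iso_trans graph_iso_sym
      by (metis linorder_neqE_nat)
    then show ?thesis using i by blast
  qed
  then show ?thesis using hyp by blast
qed

end
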